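(* Let $A\in\mathbb{C}^{2\times2}$ be non-singular. Then $AD$ is self-adjoint if and only if $A$ is real and diagonal.
   Context: Let $W^{2,2}$ be the Sobolev space of all $f\in L^2(0,1)\otimes\mathbb{C}^2$ whose generalized derivative $f''$ lies in $L^2(0,1)\otimes\mathbb{C}^2$, and write $f=\begin{pmatrix}\phi\\ \gamma\end{pmatrix}$. The operator $D$ acts on $L^2(0,1)\otimes\mathbb{C}^2$ by $Df=-f''$ with domain $\mathrm{Dom}(D)=\{f\in W^{2,2}:\phi(0)=\phi(1)=0,\ \gamma'(0)=\gamma'(1)=0\}$. $AD$ is the operator $f\mapsto -Af''$ with domain $\mathrm{Dom}(D)$. *)

theory Defs
  imports "HOL-Analysis.Analysis"
begin

(* Elements of L^2(0,1) \<otimes> C^2 are handled through representatives of type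
   real => complex^2.  Only the values on (0,1), up to null sets, matter: every operator below
   is a graph that is closed under changing either component of a pair on a null set. *)

abbreviation unit_interval :: "real measure" where
  "unit_interval \<equiv> lebesgue_on {0<..<1}"

definition L2 :: "(real \<Rightarrow> complex^2) set" where
  "L2 = {f. f \<in> borel_measurable unit_interval \<and>
            integrable unit_interval (\<lambda>x. (norm (f x))\<^sup>2)}"

definition L2_inner :: "(real \<Rightarrow> complex^2) \<Rightarrow> (real \<Rightarrow> complex^2) \<Rightarrow> complex" where
  "L2_inner f g = (LINT x|unit_interval. (\<Sum>i\<in>UNIV. f x $ i * cnj (g x $ i)))"

definition L2_norm :: "(real \<Rightarrow> complex^2) \<Rightarrow> real" where
  "L2_norm f = sqrt (LINT x|unit_interval. (norm (f x))\<^sup>2)"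

type_synonym L2_operator = "((real \<Rightarrow> complex^2) \<times> (real \<Rightarrow> complex^2)) set"

definition densely_defined :: "L2_operator \<Rightarrow> bool" where
  "densely_defined T \<longleftrightarrow> (\<forall>f\<in>L2. \<forall>e>0. \<exists>u\<in>Domain T. L2_norm (\<lambda>x. f x - u x) < e)"

(* For densely defined T this is the graph of the usual adjoint: u lies in the domain of T* with
   T* u = v iff <T f, u> = <f, v> for every f in the domain of T. *)
definition adjoint_op :: "L2_operator \<Rightarrow> L2_operator" where
  "adjoint_op T = {(u, v). u \<in> L2 \<and> v \<in> L2 \<and> (\<forall>(f, g)\<in>T. L2_inner g u = L2_inner f v)}"

definition self_adjoint :: "L2_operator \<Rightarrow> bool" where
  "self_adjoint T \<longleftrightarrow> densely_defined T \<and> adjoint_op T = T"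

definition test_function :: "(real \<Rightarrow> real) \<Rightarrow> bool" where
  "test_function \<psi> \<longleftrightarrow>
     (\<forall>n x. ((deriv ^^ n) \<psi>) field_differentiable (at x)) \<and>
     (\<exists>a b. 0 < a \<and> b < 1 \<and> (\<forall>x. x \<notin> {a..b} \<longrightarrow> \<psi> x = 0))"

definition generalized_deriv ::
    "nat \<Rightarrow> (real \<Rightarrow> complex^2) \<Rightarrow> (real \<Rightarrow> complex^2) \<Rightarrow> bool" where
  "generalized_deriv n f g \<longleftrightarrow>
     (\<forall>\<psi>. test_function \<psi> \<longrightarrow>
        (LINT x|unit_interval. (deriv ^^ n) \<psi> x *\<^sub>R f x) =
        (-1) ^ n *\<^sub>R (LINT x|unit_interval. \<psi> x *\<^sub>R g x))"

definition W22 :: "(real \<Rightarrow> complex^2) set" where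
  "W22 = {f \<in> L2. \<exists>g\<in>L2. generalized_deriv 2 f g}"

(* Every f in W22 agrees almost everywhere on (0,1) with exactly one continuously differentiable
   function on [0,1]; boundary values of f and f' are those of this representative F and of its
   (at the end points one-sided) derivative F'. *)
definition C1_representative ::
    "(real \<Rightarrow> complex^2) \<Rightarrow> (real \<Rightarrow> complex^2) \<Rightarrow> (real \<Rightarrow> complex^2) \<Rightarrow> bool" where
  "C1_representative f F F' \<longleftrightarrow>
     (AE x in unit_interval. f x = F x) \<and>
     (\<forall>x\<in>{0..1}. (F has_vector_derivative F' x) (at x within {0..1})) \<and>
     continuous_on {0..1} F'"

definition Dom_D :: "(real \<Rightarrow> complex^2) set" where
  "Dom_D = {f \<in> W22. \<exists>F F'. C1_representative f F F' \<and>
              F 0 $ 1 = 0 \<and> F 1 $ 1 = 0 \<and> F' 0 $ 2 = 0 \<and> F' 1 $ 2 = 0}"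

definition D_op :: L2_operator where
  "D_op = {(f, g). f \<in> Dom_D \<and> g \<in> L2 \<and>
             (\<exists>h\<in>L2. generalized_deriv 2 f h \<and> (AE x in unit_interval. g x = - h x))}"

definition matrix_op :: "complex^2^2 \<Rightarrow> L2_operator \<Rightarrow> L2_operator" where
  "matrix_op A T = {(f, k). k \<in> L2 \<and> (\<exists>g. (f, g) \<in> T \<and> (AE x in unit_interval. k x = A *v g x))}"

definition real_matrix :: "complex^2^2 \<Rightarrow> bool" where
  "real_matrix A \<longleftrightarrow> (\<forall>i j. A $ i $ j \<in> \<real>)"

definition diagonal_matrix :: "complex^2^2 \<Rightarrow> bool" where
  "diagonal_matrix A \<longleftrightarrow> (\<forall>i j. i \<noteq> j \<longrightarrow> A $ i $ j = 0)"

end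

(* A pair (f, k) lies in the graph of AD exactly when f has a C^1 representative F with the boundary
   conditions, F' is an indefinite integral of some h in L^2, and k = -Ah almost everywhere; passing
   from generalized derivatives to this form is du Bois-Reymond's lemma, obtained by testing against
   smooth approximations of indicator functions of intervals.  If A is real and diagonal, Green's
   formula has no boundary terms, so AD is symmetric.  Given (u, v) in the graph of the adjoint, one
   solves AD U = v (the constant function e_2 shows that v_2 has mean zero) with U_2 normalized so
   that u_2 - U_2 also has mean zero; then u - U is in the range of AD, and symmetry makes it
   orthogonal to itself, whence u = U.
   Conversely, a symmetric AD tested on x^2(1-x)^2 e_i and x^2(1-x)^2 e_j forces A to be Hermitian,
   and tested on x(1-x) e_1 and e_2 forces the entry A_21 to vanish. *)

theory Submission imports Defs "HOL-Computational_Algebra.Polynomial" begin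

section \<open>Integration by parts against an indefinite integral\<close>

text \<open>Second derivatives of domain elements are merely integrable, so F' need not be
  differentiable at a given point and the pointwise product rule fails for F' G. Integration by
  parts is therefore derived from Fubini's theorem for a function given as an indefinite integral.
  Weak derivatives are tested only against smooth functions supported inside (0,1), so a concrete
  step is built from exp(-1/(t(1-t))), and its identities reach the end points by continuity.

  The criterion on A comes from the boundary form <A F', G> - <A F, G'>. The boundary conditions
  kill every product of equal components, but leave the first component of F' and the second
  component of G free, and A_21 couples exactly these two. Hence being Hermitian does not suffice.

  The constant e_2 spans the kernel of AD for non-singular A, so AD has no inverse; for diagonal A
  its range consists of the functions whose second component has mean zero. This is the source of
  both normalizations of means. Density of the domain is a separate matter: polynomials with double
  zeros at 0 and 1 satisfy all four boundary conditions at once.\<close>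

lemma lebesgue_on_integral_eqI:
  fixes f :: "'a::euclidean_space \<Rightarrow> 'b::euclidean_space"
  assumes "f absolutely_integrable_on S" "S \<in> sets lebesgue" "(f has_integral y) S"
  shows "integral\<^sup>L (lebesgue_on S) f = y"
  using lebesgue_integral_eq_integral[OF absolutely_integrable_imp_integrable[OF assms(1,2)] assms(2)]
    integral_unique[OF assms(3)] by simp

lemma absolutely_integrable_bilinear_continuous:
  fixes prod :: "'a::euclidean_space \<Rightarrow> 'b::euclidean_space \<Rightarrow> 'c::euclidean_space"
  assumes "bounded_bilinear prod" "h absolutely_integrable_on {a..b::real}" "continuous_on {a..b} k"
  shows "(\<lambda>x. prod (h x) (k x)) absolutely_integrable_on {a..b}"
proof (rule absolutely_integrable_bounded_measurable_product[where h = "\<lambda>x y. prod y x"])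
  show "bilinear (\<lambda>x y. prod y x)"
    using assms(1) by (simp add: bilinear_conv_bounded_bilinear bounded_bilinear.flip)
  show "k \<in> borel_measurable (lebesgue_on {a..b})"
    using assms(3) by (simp add: continuous_imp_measurable_on_sets_lebesgue)
  show "bounded (k ` {a..b})"
    using assms(3) by (simp add: compact_continuous_image compact_imp_bounded)
qed (use assms in auto)

text \<open>Since \<open>H\<close> is only an indefinite integral of \<open>h\<close>, the
  fundamental theorem is not applied to the product. Instead \<open>k b - k t\<close> is written as
  the integral of \<open>k'\<close> over \<open>{t..b}\<close>, and exchanging the order of
  integration turns the integral of \<open>prod (h t) (k b - k t)\<close> into that of
  \<open>prod (H s - H a) (k' s)\<close>. A general bilinear \<open>prod\<close> covers both scalar
  multiplication by test functions and the form \<open>cinner (A *v x) y\<close>.\<close>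

lemma integration_by_parts_indefinite:
  fixes prod :: "'a::euclidean_space \<Rightarrow> 'b::euclidean_space \<Rightarrow> 'c::euclidean_space"
  assumes bil: "bounded_bilinear prod" and ab: "a \<le> (b::real)"
    and h: "h absolutely_integrable_on {a..b}"
    and H: "\<And>x. x \<in> {a..b} \<Longrightarrow> (h has_integral (H x - H a)) {a..x}"
    and k: "\<And>x. x \<in> {a..b} \<Longrightarrow> (k has_vector_derivative k' x) (at x within {a..b})"
    and k': "continuous_on {a..b} k'"
  shows "((\<lambda>x. prod (h x) (k x)) has_integral
           (prod (H b) (k b) - prod (H a) (k a) - integral {a..b} (\<lambda>x. prod (H x) (k' x)))) {a..b}"
proof -
  interpret P: bounded_bilinear prod by fact
  define M where "M = lebesgue_on {a..b}"
  have Ms: "{a..b} \<in> sets lebesgue" by simp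
  interpret fM: finite_measure M
    unfolding M_def by (rule finite_measure_lebesgue_on) simp
  interpret PM: pair_sigma_finite M M ..
  have contk: "continuous_on {a..b} k"
    by (rule continuous_on_vector_derivative[OF k])
  have contH: "continuous_on {a..b} H"
  proof -
    have "continuous_on {a..b} (\<lambda>x. integral {a..x} h)"
      using H[of b] ab by (intro indefinite_integral_continuous_1) (auto simp: has_integral_integrable)
    then have "continuous_on {a..b} (\<lambda>x. integral {a..x} h + H a)"
      by (intro continuous_intros)
    then show ?thesis
      by (rule continuous_on_eq) (simp add: integral_unique[OF H])
  qed
  have intk: "(k' has_integral (k x - k t)) {t..x}" if "a \<le> t" "t \<le> x" "x \<le> b" for t x
  proof (rule fundamental_theorem_of_calculus)
    fix s assume "s \<in> {t..x}"
    then show "(k has_vector_derivative k' s) (at s within {t..x})"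
      using that by (intro has_vector_derivative_within_subset[OF k]) auto
  qed (use that in auto)
  have hM[measurable]: "h \<in> borel_measurable M" and kM[measurable]: "k' \<in> borel_measurable M"
    using h k' unfolding M_def
    by (auto intro!: borel_measurable_integrable absolutely_integrable_imp_integrable
        absolutely_integrable_continuous_real)
  have hI: "integrable M h"
    unfolding M_def using h by (rule absolutely_integrable_imp_integrable) simp
  have kI: "integrable M k'"
    unfolding M_def using k' by (rule continuous_imp_integrable_real)
  \<comment> \<open>Fubini on the triangle \<open>t \<le> s\<close>.\<close>
  define g where "g p = indicator {p. fst p \<le> snd p} p *\<^sub>R prod (h (fst p)) (k' (snd p))" for p :: "real \<times> real"
  have [measurable]: "fst \<in> borel_measurable (M \<Otimes>\<^sub>M M)" "snd \<in> borel_measurable (M \<Otimes>\<^sub>M M)"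
  proof -
    have id: "(\<lambda>x. x) \<in> borel_measurable M"
      unfolding M_def by (simp add: continuous_imp_measurable_on_sets_lebesgue)
    show "fst \<in> borel_measurable (M \<Otimes>\<^sub>M M)"
      by (rule measurable_compose[OF measurable_fst id])
    show "snd \<in> borel_measurable (M \<Otimes>\<^sub>M M)"
      by (rule measurable_compose[OF measurable_snd id])
  qed
  have gM[measurable]: "g \<in> borel_measurable (M \<Otimes>\<^sub>M M)"
  proof -
    have "(\<lambda>p. prod (h (fst p)) (k' (snd p))) \<in> borel_measurable (M \<Otimes>\<^sub>M M)"
      by (rule borel_measurable_continuous_Pair)
         (auto intro!: P.continuous_on continuous_intros)
    moreover have "(\<lambda>p. indicator {p. fst p \<le> snd p} p :: real) \<in> borel_measurable (M \<Otimes>\<^sub>M M)"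
      by (rule borel_measurable_indicator') measurable
    ultimately show ?thesis
      unfolding g_def by (rule borel_measurable_scaleR[rotated])
  qed
  have prodI: "integrable M (\<lambda>s. prod x (k' s))" for x
    using integrable_bounded_linear[OF P.bounded_linear_right kI] .
  have slice1: "integrable M (\<lambda>s. g (t, s))" for t
  proof (rule Bochner_Integration.integrable_bound[OF prodI[of "h t"]])
    show "(\<lambda>s. g (t, s)) \<in> borel_measurable M"
    proof -
      have "(\<lambda>s. indicator {t..} s *\<^sub>R prod (h t) (k' s)) \<in> borel_measurable M"
        using borel_measurable_integrable[OF prodI[of "h t"]]
        by (intro borel_measurable_scaleR borel_measurable_indicator')
           (auto simp: M_def sets_restrict_space intro!: image_eqI[of _ _ "{t..}"])
      then show ?thesis by (simp add: g_def indicator_def)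
    qed
  qed (auto simp: g_def indicator_def)
  obtain C where C: "\<And>x y. norm (prod x y) \<le> norm x * norm y * C" "C \<ge> 0"
    using P.nonneg_bounded by blast
  obtain B where B: "\<And>s. s \<in> {a..b} \<Longrightarrow> norm (k' s) \<le> B"
    using compact_imp_bounded[OF compact_continuous_image[OF k' compact_Icc]] unfolding bounded_iff by blast
  \<comment> \<open>\<open>k'\<close> is bounded by \<open>B\<close> on the compact interval, so the
    inner integral of the norm is at most a constant times \<open>norm (h x)\<close>, which is
    integrable.\<close>
  have gI: "integrable (M \<Otimes>\<^sub>M M) g"
  proof (rule PM.Fubini_integrable)
    show "integrable M (\<lambda>x. \<integral>y. norm (g (x, y)) \<partial>M)"
    proof (rule Bochner_Integration.integrable_bound)
      show "integrable M (\<lambda>x. norm (h x) * (C * B * measure M (space M)))"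
        using hI by simp
      show "AE x in M. norm (\<integral>y. norm (g (x, y)) \<partial>M) \<le> norm (norm (h x) * (C * B * measure M (space M)))"
      proof (rule AE_I2)
        fix x
        have "(\<integral>y. norm (g (x, y)) \<partial>M) \<le> (\<integral>y. norm (h x) * (C * B) \<partial>M)"
        proof (rule integral_mono)
          fix y assume "y \<in> space M"
          then have y: "norm (k' y) \<le> B" by (auto simp: M_def intro: B)
          have "norm (g (x,y)) \<le> norm (h x) * norm (k' y) * C"
            using C(1)[of "h x" "k' y"] C(2) by (auto simp: g_def indicator_def)
          also have "\<dots> \<le> norm (h x) * (C * B)"
            using mult_left_mono[OF mult_left_mono[OF y C(2)], of "norm (h x)"] by (simp add: mult_ac)
          finally show "norm (g (x,y)) \<le> norm (h x) * (C * B)" .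
        qed (use slice1 in auto)
        also have "\<dots> = norm (h x) * (C * B * measure M (space M))" by simp
        finally have "(\<integral>y. norm (g (x, y)) \<partial>M) \<le> norm (h x) * (C * B * measure M (space M))" .
        moreover have "0 \<le> (\<integral>y. norm (g (x, y)) \<partial>M)" by simp
        ultimately show "norm (\<integral>y. norm (g (x, y)) \<partial>M) \<le> norm (norm (h x) * (C * B * measure M (space M)))"
          by simp
      qed
    qed measurable
  qed (use slice1 in auto)
  have gI': "integrable (M \<Otimes>\<^sub>M M) (\<lambda>(x, y). g (x, y))"
    using gI by simp
  \<comment> \<open>For fixed \<open>t\<close> the slice of the triangle is \<open>{t..b}\<close>;
    for fixed \<open>s\<close> it is \<open>{a..s}\<close>.\<close>
  have inner1: "(\<integral>s. g (t, s) \<partial>M) = prod (h t) (k b - k t)" if t: "t \<in> {a..b}" for t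
  proof -
    have "((\<lambda>s. prod (h t) (k' s)) has_integral prod (h t) (k b - k t)) {t..b}"
      using has_integral_linear[OF intk[of t b] P.bounded_linear_right[of "h t"]] t by (simp add: o_def)
    then have "((\<lambda>s. if s \<in> {t..b} then prod (h t) (k' s) else 0) has_integral prod (h t) (k b - k t)) {a..b}"
      using t by (subst has_integral_restrict) auto
    then have "((\<lambda>s. g (t, s)) has_integral prod (h t) (k b - k t)) {a..b}"
      by (rule has_integral_eq[rotated]) (auto simp: g_def)
    then show ?thesis
      using slice1[of t] lebesgue_integral_eq_integral[OF _ Ms, of "\<lambda>s. g (t, s)"]
      unfolding M_def by (simp add: integral_unique)
  qed
  have inner2: "(\<integral>t. g (t, s) \<partial>M) = prod (H s - H a) (k' s)" if s: "s \<in> {a..b}" for s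
  proof -
    have "((\<lambda>t. prod (h t) (k' s)) has_integral prod (H s - H a) (k' s)) {a..s}"
      using has_integral_linear[OF H[OF s] P.bounded_linear_left[of "k' s"]] by (simp add: o_def)
    then have *: "((\<lambda>t. if t \<in> {a..s} then prod (h t) (k' s) else 0) has_integral prod (H s - H a) (k' s)) {a..b}"
      using s by (subst has_integral_restrict) auto
    have **: "((\<lambda>t. g (t, s)) has_integral prod (H s - H a) (k' s)) {a..b}"
      by (rule has_integral_eq[OF _ *]) (auto simp: g_def)
    have "integrable M (\<lambda>t. g (t, s))"
    proof (rule Bochner_Integration.integrable_bound)
      show "integrable M (\<lambda>t. prod (h t) (k' s))"
        using integrable_bounded_linear[OF P.bounded_linear_left hI] .
      then have "(\<lambda>t. indicator {..s} t *\<^sub>R prod (h t) (k' s)) \<in> borel_measurable M"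
        by (intro borel_measurable_scaleR borel_measurable_indicator')
           (auto simp: M_def sets_restrict_space intro!: image_eqI[of _ _ "{..s}"])
      then show "(\<lambda>t. g (t, s)) \<in> borel_measurable M" by (simp add: g_def indicator_def)
    qed (auto simp: g_def indicator_def)
    then show ?thesis
      using lebesgue_integral_eq_integral[OF _ Ms, of "\<lambda>t. g (t, s)"] **
      unfolding M_def by (simp add: integral_unique)
  qed
  have hkA: "(\<lambda>x. prod (h x) (k x)) absolutely_integrable_on {a..b}"
    by (rule absolutely_integrable_bilinear_continuous[OF bil h contk])
  have fub: "(\<integral>s. prod (H s - H a) (k' s) \<partial>M) = (\<integral>t. prod (h t) (k b - k t) \<partial>M)"
  proof -
    have "(\<integral>s. prod (H s - H a) (k' s) \<partial>M) = (\<integral>s. (\<integral>t. g (t, s) \<partial>M) \<partial>M)"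
      by (rule Bochner_Integration.integral_cong) (auto simp: M_def inner2[unfolded M_def])
    also have "\<dots> = (\<integral>t. (\<integral>s. g (t, s) \<partial>M) \<partial>M)"
      by (rule PM.Fubini_integral) (use gI' in simp)
    also have "\<dots> = (\<integral>t. prod (h t) (k b - k t) \<partial>M)"
      by (rule Bochner_Integration.integral_cong) (auto simp: M_def inner1[unfolded M_def])
    finally show ?thesis .
  qed
  have R: "(\<integral>t. prod (h t) (k b - k t) \<partial>M) = prod (H b - H a) (k b) - integral {a..b} (\<lambda>t. prod (h t) (k t))"
  proof -
    have 1: "((\<lambda>t. prod (h t) (k b)) has_integral prod (H b - H a) (k b)) {a..b}"
      using has_integral_linear[OF H[of b] P.bounded_linear_left[of "k b"]] ab by (simp add: o_def)
    have "((\<lambda>t. prod (h t) (k b) - prod (h t) (k t)) has_integral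
       prod (H b - H a) (k b) - integral {a..b} (\<lambda>t. prod (h t) (k t))) {a..b}"
      using hkA by (intro has_integral_diff 1 integrable_integral) (auto simp: absolutely_integrable_on_def)
    then show ?thesis unfolding M_def P.diff_right[symmetric]
      by (intro lebesgue_on_integral_eqI absolutely_integrable_bilinear_continuous[OF bil h])
         (auto intro!: continuous_intros contk)
  qed
  have Hk': "continuous_on {a..b} (\<lambda>s. prod (H s) (k' s))"
    by (intro P.continuous_on contH k')
  have L: "(\<integral>s. prod (H s - H a) (k' s) \<partial>M) = integral {a..b} (\<lambda>s. prod (H s) (k' s)) - prod (H a) (k b - k a)"
  proof -
    have 1: "((\<lambda>s. prod (H a) (k' s)) has_integral prod (H a) (k b - k a)) {a..b}"
      using has_integral_linear[OF intk[of a b] P.bounded_linear_right[of "H a"]] ab by (simp add: o_def)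
    have "((\<lambda>s. prod (H s) (k' s) - prod (H a) (k' s)) has_integral
        integral {a..b} (\<lambda>s. prod (H s) (k' s)) - prod (H a) (k b - k a)) {a..b}"
      using Hk' by (intro has_integral_diff 1 integrable_integral integrable_continuous_real)
    moreover have "(\<lambda>s. prod (H s - H a) (k' s)) absolutely_integrable_on {a..b}"
      by (intro absolutely_integrable_continuous_real P.continuous_on contH k' continuous_intros)
    ultimately show ?thesis unfolding M_def P.diff_left[symmetric]
      by (intro lebesgue_on_integral_eqI) auto
  qed
  \<comment> \<open>When the two evaluations of the double integral are compared, the mixed term
    \<open>prod (H a) (k b)\<close> cancels.\<close>
  have "integral {a..b} (\<lambda>t. prod (h t) (k t))
     = prod (H b) (k b) - prod (H a) (k a) - integral {a..b} (\<lambda>x. prod (H x) (k' x))"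
    using fub unfolding L R by (simp add: P.diff_left P.diff_right algebra_simps)
  then show ?thesis
    using hkA by (metis absolutely_integrable_on_def integrable_integral)
qed

text \<open>The substitute for "\<open>F\<close> is twice weakly differentiable with
  \<open>F'' = h\<close>". The last clause says that \<open>p = F'\<close> is absolutely continuous
  with derivative \<open>h\<close> almost everywhere, in a form that sees \<open>h\<close> only up
  to null sets.\<close>

definition second_order_primitive ::
    "(real \<Rightarrow> 'a::euclidean_space) \<Rightarrow> (real \<Rightarrow> 'a) \<Rightarrow> (real \<Rightarrow> 'a) \<Rightarrow> bool" where
  "second_order_primitive F p h \<longleftrightarrow>
     h absolutely_integrable_on {0..1} \<and>
     (\<forall>x\<in>{0..1}. (F has_vector_derivative p x) (at x within {0..1})) \<and>
     (\<forall>x\<in>{0..1}. (h has_integral (p x - p 0)) {0..x})"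

lemma second_order_primitive_continuous:
  assumes "second_order_primitive F p h"
  shows "continuous_on {0..1} F" "continuous_on {0..1} p"
proof -
  show "continuous_on {0..1} F"
    using assms continuous_on_vector_derivative unfolding second_order_primitive_def by blast
  have int: "\<And>x. x \<in> {0..1} \<Longrightarrow> (h has_integral (p x - p 0)) {0..x}"
    using assms unfolding second_order_primitive_def by blast
  have "continuous_on {0..1} (\<lambda>x. integral {0..x} h)"
    using int[of 1] by (intro indefinite_integral_continuous_1) (auto simp: has_integral_integrable)
  then have "continuous_on {0..1} (\<lambda>x. integral {0..x} h + p 0)"
    by (intro continuous_intros)
  then show "continuous_on {0..1} p"
    by (rule continuous_on_eq) (simp add: integral_unique[OF int])
qed

text \<open>Both integrals equal boundary terms minus the same integral of
  \<open>prod (p x) (q x)\<close>, which drops out of the difference. The second integration by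
  parts uses the flipped \<open>prod\<close>, because the factor that is merely integrable has to
  stand first.\<close>

lemma Green_second_order_primitive:
  fixes prod :: "'a::euclidean_space \<Rightarrow> 'b::euclidean_space \<Rightarrow> 'c::euclidean_space"
  assumes bil: "bounded_bilinear prod"
    and F: "second_order_primitive F p h" and G: "second_order_primitive G q k"
  shows "integral {0..1} (\<lambda>x. prod (h x) (G x)) - integral {0..1} (\<lambda>x. prod (F x) (k x)) =
    prod (p 1) (G 1) - prod (p 0) (G 0) - (prod (F 1) (q 1) - prod (F 0) (q 0))"
proof -
  have 1: "((\<lambda>x. prod (h x) (G x)) has_integral
           (prod (p 1) (G 1) - prod (p 0) (G 0) - integral {0..1} (\<lambda>x. prod (p x) (q x)))) {0..1}"
    using F G second_order_primitive_continuous[OF G]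
    by (intro integration_by_parts_indefinite[OF bil]) (auto simp: second_order_primitive_def)
  have 2: "((\<lambda>x. prod (F x) (k x)) has_integral
           (prod (F 1) (q 1) - prod (F 0) (q 0) - integral {0..1} (\<lambda>x. prod (p x) (q x)))) {0..1}"
    using F G second_order_primitive_continuous[OF F]
    by (intro integration_by_parts_indefinite[OF bounded_bilinear.flip[OF bil]]) (auto simp: second_order_primitive_def)
  show ?thesis using 1 2 by (simp add: integral_unique)
qed

section \<open>Smooth step functions\<close>

text \<open>Smoothness by coinduction: it suffices to exhibit a family of functions closed under differentiation.\<close>

lemma all_derivs_differentiableI:
  fixes f :: "'a::real_normed_field \<Rightarrow> 'a"
  assumes "f \<in> \<F>"
    and closed: "\<And>g. g \<in> \<F> \<Longrightarrow> \<exists>g'\<in>\<F>. \<forall>x. (g has_field_derivative g' x) (at x)"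
  shows "((deriv ^^ n) f) field_differentiable (at x)"
proof -
  have deriv_in: "deriv g \<in> \<F>" if g: "g \<in> \<F>" for g
  proof -
    obtain g' where g': "g' \<in> \<F>" "\<forall>x. (g has_field_derivative g' x) (at x)"
      using closed[OF g] by blast
    then have "deriv g = g'" by (auto intro: DERIV_imp_deriv)
    then show ?thesis using g' by simp
  qed
  have "(deriv ^^ n) f \<in> \<F>"
    by (induction n) (use assms(1) deriv_in in auto)
  then show ?thesis
    using closed unfolding field_differentiable_def by blast
qed

text \<open>The bound forces \<open>f a = 0\<close> and makes the difference quotient at most
  \<open>C * \<bar>t - a\<bar>\<close>. It handles the points where \<open>bump\<close> is glued to
  zero.\<close>

lemma has_field_derivative_zero_quadratic:
  fixes f :: "real \<Rightarrow> real"
  assumes "\<And>t. \<bar>f t\<bar> \<le> C * (t - a)\<^sup>2"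
  shows "(f has_field_derivative 0) (at a)"
proof -
  have fa: "f a = 0" using assms[of a] by simp
  have "((\<lambda>t. (f t - f a) / (t - a)) \<longlongrightarrow> 0) (at a)"
  proof (rule Lim_null_comparison[where g = "\<lambda>t. C * \<bar>t - a\<bar>"])
    show "\<forall>\<^sub>F t in at a. norm ((f t - f a) / (t - a)) \<le> C * \<bar>t - a\<bar>"
    proof (rule eventually_at_filter[THEN iffD2, OF always_eventually], safe)
      fix t assume "t \<noteq> a"
      then show "norm ((f t - f a) / (t - a)) \<le> C * \<bar>t - a\<bar>"
        using assms[of t] by (simp add: fa abs_divide divide_le_eq power2_eq_square mult.assoc)
    qed
    have "((\<lambda>t. C * \<bar>t - a\<bar>) \<longlongrightarrow> C * \<bar>a - a\<bar>) (at a)"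
      by (intro tendsto_intros)
    then show "((\<lambda>t. C * \<bar>t - a\<bar>) \<longlongrightarrow> 0) (at a)" by simp
  qed
  then show ?thesis by (simp add: has_field_derivative_iff)
qed

text \<open>Keeping a polynomial \<open>P\<close> and an exponent \<open>k\<close> makes this family closed under differentiation.\<close>

definition bump :: "real poly \<Rightarrow> nat \<Rightarrow> real \<Rightarrow> real" where
  "bump P k t = (if 0 < t \<and> t < 1 then poly P t * exp (- 1 / (t * (1 - t))) / (t * (1 - t)) ^ k else 0)"

text \<open>With q = t(1-t) and n = k + 2, exp(1/q) >= (1 + 1/(qn))^n >= (1/q)^n / n^n, so exp(-1/q)
  <= n^n q^n. Taking two powers more than \<open>k\<close> leaves the factor q^2 after division by
  q^k: a double zero at 0 and at 1.\<close>

lemma bump_bound: "\<exists>C. \<forall>t. \<bar>bump P k t\<bar> \<le> C * (t * (1 - t))\<^sup>2"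
proof -
  have "compact ((poly P) ` {0..1})"
    by (intro compact_continuous_image continuous_intros) auto
  then obtain B where B: "\<And>t. t \<in> {0..1} \<Longrightarrow> \<bar>poly P t\<bar> \<le> B"
    by (meson bounded_real compact_imp_bounded imageI)
  define D where "D = real (k + 2) ^ (k + 2)"
  have D: "D > 0" by (simp add: D_def)
  have "\<bar>bump P k t\<bar> \<le> (B * D) * (t * (1 - t))\<^sup>2" for t
  proof (cases "0 < t \<and> t < 1")
    case True
    define q where "q = t * (1 - t)"
    have q: "q > 0" using True by (simp add: q_def)
    have B0: "B \<ge> 0" using B[of 0] by simp
    have "(1 / q) ^ (k + 2) / real (k + 2) ^ (k + 2) \<le> (1 + (1 / q) / real (k + 2)) ^ (k + 2)"
      unfolding power_divide[symmetric] using q by (intro power_mono) auto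
    also have "\<dots> \<le> exp (1 / q)"
      using q by (intro exp_ge_one_plus_x_over_n_power_n) (auto intro: order_trans[of _ 0])
    finally have "(1 / q) ^ (k + 2) / real (k + 2) ^ (k + 2) \<le> exp (1 / q)" .
    then have "(1 / q) ^ (k + 2) / D \<le> exp (1 / q)" by (simp only: D_def)
    then have "1 \<le> exp (1 / q) * (D * q ^ (k + 2))"
      using q D by (simp only: power_divide power_one divide_divide_eq_left)
        (simp add: divide_le_eq mult_ac)
    then have "exp (- 1 / q) \<le> D * q ^ (k + 2)"
      using mult_left_mono[of 1 "exp (1 / q) * (D * q ^ (k + 2))" "exp (- 1 / q)"]
      by (simp add: mult.assoc[symmetric] exp_add[symmetric])
    then have "exp (- 1 / q) \<le> D * q\<^sup>2 * q ^ k" by (simp only: power_add mult_ac)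
    then have "exp (- 1 / q) / q ^ k \<le> D * q\<^sup>2"
      using q by (simp add: divide_le_eq)
    then have "\<bar>poly P t\<bar> * (exp (- 1 / q) / q ^ k) \<le> B * (D * q\<^sup>2)"
      using q True B[of t] B0 by (intro mult_mono) auto
    then show ?thesis
      using True q by (simp add: bump_def q_def[symmetric] abs_mult mult.assoc)
  next
    case False
    then show ?thesis
      using B[of 0] D by (auto simp: bump_def)
  qed
  then show ?thesis by blast
qed

text \<open>On (0,1), with q = t(1-t), the derivative of P exp(-1/q) / q^k is (P' q^2 - k P q' q + P
  q') exp(-1/q) / q^(k+2); the new polynomial and the exponent \<open>k + 2\<close> are read off
  from this. At 0 and 1 the quadratic bound gives derivative 0.\<close>

lemma bump_has_field_derivative:
  "\<exists>P' k'. \<forall>t. (bump P k has_field_derivative bump P' k' t) (at t)"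
proof -
  define q :: "real poly" where "q = [:0, 1, -1:]"
  have q: "poly q t = t * (1 - t)" "poly (pderiv q) t = 1 - 2 * t" for t
    by (simp_all add: q_def pderiv_pCons algebra_simps)
  define P' where "P' = pderiv P * q\<^sup>2 - smult (of_nat k) (P * pderiv q * q) + P * pderiv q"
  obtain C where C: "\<And>t. \<bar>bump P k t\<bar> \<le> C * (t * (1 - t))\<^sup>2" using bump_bound by blast
  have C0: "C \<ge> 0" using C[of "1/2"] by (simp add: power2_eq_square)
  have "(bump P k has_field_derivative bump P' (k + 2) t) (at t)" for t
  proof -
    consider "t < 0" | "t > 1" | "t = 0" | "t = 1" | "0 < t" "t < 1" by linarith
    then show ?thesis
    proof cases
      case 1
      have "((\<lambda>_. 0) has_field_derivative 0) (at t)" by simp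
      then have "(bump P k has_field_derivative 0) (at t)"
        by (rule has_field_derivative_transform_within_open[where S = "{..<0}"])
           (use 1 in \<open>auto simp: bump_def\<close>)
      then show ?thesis using 1 by (simp add: bump_def[of P'])
    next
      case 2
      have "((\<lambda>_. 0) has_field_derivative 0) (at t)" by simp
      then have "(bump P k has_field_derivative 0) (at t)"
        by (rule has_field_derivative_transform_within_open[where S = "{1<..}"])
           (use 2 in \<open>auto simp: bump_def\<close>)
      then show ?thesis using 2 by (simp add: bump_def[of P'])
    next
      case 3
      have "\<bar>bump P k s\<bar> \<le> C * (s - 0)\<^sup>2" for s
      proof (cases "0 < s \<and> s < 1")
        case True
        then have "(s * (1 - s))\<^sup>2 \<le> s\<^sup>2" by (intro power_mono) (auto simp: mult_left_le)
        then have "C * (s * (1 - s))\<^sup>2 \<le> C * s\<^sup>2" using C0 by (intro mult_left_mono)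
        then show ?thesis using C[of s] by simp
      qed (use C0 in \<open>auto simp: bump_def\<close>)
      from has_field_derivative_zero_quadratic[OF this] show ?thesis
        using 3 by (simp add: bump_def[of P'])
    next
      case 4
      have "\<bar>bump P k s\<bar> \<le> C * (s - 1)\<^sup>2" for s
      proof (cases "0 < s \<and> s < 1")
        case True
        then have "(s * (1 - s))\<^sup>2 \<le> (1 - s)\<^sup>2" by (intro power_mono) (auto simp: mult_left_le_one_le)
        then have "C * (s * (1 - s))\<^sup>2 \<le> C * (1 - s)\<^sup>2" using C0 by (intro mult_left_mono)
        then show ?thesis using C[of s] by (simp add: power2_commute)
      qed (use C0 in \<open>auto simp: bump_def\<close>)
      from has_field_derivative_zero_quadratic[OF this] show ?thesis
        using 4 by (simp add: bump_def[of P'])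
    next
      case 5
      define e where "e = exp (- 1 / poly q t)"
      have q0: "poly q t > 0" using 5 by (simp add: q)
      have "((\<lambda>t. poly P t * exp (- 1 / poly q t) / poly q t ^ k) has_field_derivative
          ((poly (pderiv P) t * e + poly P t * (e * (poly (pderiv q) t / (poly q t)\<^sup>2))) * poly q t ^ k
            - poly P t * e * (of_nat k * poly q t ^ (k - 1) * poly (pderiv q) t)) / (poly q t ^ k * poly q t ^ k)) (at t)"
        unfolding e_def using q0
        by (auto intro!: derivative_eq_intros simp: power2_eq_square)
      \<comment> \<open>The exponent \<open>k - 1\<close> is truncated at \<open>k = 0\<close>,
        where its coefficient is 0; this case is separate. For \<open>k = Suc m\<close> the identity
        is proved over free reals, with \<open>z\<close> standing for the power
        \<open>poly q t ^ m\<close>.\<close>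
      also have "((poly (pderiv P) t * e + poly P t * (e * (poly (pderiv q) t / (poly q t)\<^sup>2))) * poly q t ^ k
            - poly P t * e * (of_nat k * poly q t ^ (k - 1) * poly (pderiv q) t)) / (poly q t ^ k * poly q t ^ k)
          = poly P' t * e / poly q t ^ (k + 2)"
      proof (cases k)
        case 0
        then show ?thesis using q0 by (simp add: P'_def field_simps power2_eq_square)
      next
        case (Suc m)
        have "poly q t ^ m > 0" using q0 by simp
        moreover have "((p' * e + p * (e * (r' / (r * r)))) * (r * z) - p * e * (j * z * r')) / ((r * z) * (r * z)) =
            ((p' * (r * r) - j * (p * r' * r) + p * r') * e) / (r * (r * (r * z)))"
          if "r > 0" "z > 0" for p p' r r' z j e :: real
          using that by (simp add: field_simps)
        ultimately show ?thesis using q0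
          by (simp add: Suc P'_def power2_eq_square)
      qed
      finally have "((\<lambda>t. poly P t * exp (- 1 / poly q t) / poly q t ^ k) has_field_derivative bump P' (k + 2) t) (at t)"
        using 5 by (simp add: bump_def[of P'] e_def q)
      then show ?thesis
        by (rule has_field_derivative_transform_within_open[where S = "{0<..<1}"])
           (use 5 in \<open>auto simp: bump_def q\<close>)
    qed
  qed
  then show ?thesis by blast
qed

lemma continuous_on_bump [continuous_intros]: "continuous_on S (bump P k)"
  using bump_has_field_derivative[of P k]
  by (meson DERIV_isCont continuous_at_imp_continuous_on)

text \<open>\<open>R\<close> is the primitive of exp(-1/(t(1-t))), normalized to total mass 1. The
  family \<open>\<F>\<close> is handed out as a certificate of smoothness, from which the smoothness
  of rescaled and translated copies of \<open>R\<close> can be derived.\<close>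

lemma exists_smooth_step:
  obtains R R' :: "real \<Rightarrow> real" and \<F> where
    "\<And>t. t \<le> 0 \<Longrightarrow> R t = 0" "\<And>t. t \<ge> 1 \<Longrightarrow> R t = 1" "\<And>t. 0 \<le> R t" "\<And>t. R t \<le> 1"
    "\<And>t. (R has_field_derivative R' t) (at t)" "\<And>t. R' t \<ge> 0"
    "\<And>t. t \<notin> {0..1} \<Longrightarrow> R' t = 0" "continuous_on UNIV R'"
    "R \<in> \<F>" "\<And>g. g \<in> \<F> \<Longrightarrow> \<exists>g'\<in>\<F>. \<forall>x. (g has_field_derivative g' x) (at x)"
proof -
  define b where "b = bump 1 0"
  have b: "b t = (if 0 < t \<and> t < 1 then exp (- 1 / (t * (1 - t))) else 0)" for t
    by (simp add: b_def bump_def)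
  have contb: "continuous_on S b" for S unfolding b_def by (rule continuous_on_bump)
  \<comment> \<open>The lower limit lies below 0, where \<open>b\<close> vanishes, so that 0 is an
    interior point of \<open>{-1..2}\<close> and the derivative obtained there is two-sided.\<close>
  define I where "I t = integral {-1..t} b" for t
  have bint: "b integrable_on {s..t}" for s t
    by (rule integrable_continuous_real[OF contb])
  have I0: "I t = 0" if "t \<le> 0" for t
  proof -
    have "I t = integral {-1..t} (\<lambda>_. 0)"
      unfolding I_def by (rule integral_cong) (use that in \<open>auto simp: b\<close>)
    then show ?thesis by simp
  qed
  have I1: "I t = I 1" if "t \<ge> 1" for t
  proof -
    have "integral {1..t} b = integral {1..t} (\<lambda>_. 0)"
      by (rule integral_cong) (auto simp: b)
    then show ?thesis
      using Henstock_Kurzweil_Integration.integral_combine[of "-1" 1 t b] that bint by (simp add: I_def)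
  qed
  define c where "c = I 1"
  have mono: "I s \<le> I t" if "s \<le> t" for s t
    unfolding I_def using that by (intro integral_subset_le bint) (auto simp: b)
  have c: "c > 0"
  proof -
    have "c \<ge> 0" using mono[of 0 1] I0[of 0] by (simp add: c_def)
    moreover have "c \<noteq> 0"
    proof
      assume "c = 0"
      then have "(b has_integral 0) (cbox (-1) 1)"
        using integrable_integral[OF bint[of "-1" 1]] by (simp add: c_def I_def)
      then have "b (1/2) = 0"
        by (intro has_integral_0_cbox_imp_0[of "-1" 1 b]) (auto simp: contb, auto simp: b)
      then show False by (simp add: b)
    qed
    ultimately show ?thesis by simp
  qed
  define R where "R t = I t / c" for t
  \<comment> \<open>Putting the factor 1/c into the polynomial keeps \<open>R'\<close> inside the
    family of bumps.\<close>
  define R' where "R' = bump [:1 / c:] 0"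
  have R': "R' t = b t / c" for t by (simp add: R'_def bump_def b)
  have dI: "(I has_field_derivative b t) (at t)" for t
  proof -
    consider "t < 0" | "t > 1" | "-1 < t" "t < 2" by linarith
    then show ?thesis
    proof cases
      case 1
      have "((\<lambda>_. 0) has_field_derivative 0) (at t)" by simp
      then have "(I has_field_derivative 0) (at t)"
        by (rule has_field_derivative_transform_within_open[where S = "{..<0}"])
           (use 1 I0 in auto)
      then show ?thesis using 1 by (simp add: b)
    next
      case 2
      have "((\<lambda>_. I 1) has_field_derivative 0) (at t)" by simp
      then have "(I has_field_derivative 0) (at t)"
        by (rule has_field_derivative_transform_within_open[where S = "{1<..}"])
           (use 2 in \<open>auto intro!: I1[symmetric]\<close>)
      then show ?thesis using 2 by (simp add: b)
    next
      case 3
      have "(I has_vector_derivative b t) (at t within {-1..2})"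
        unfolding I_def by (rule integral_has_vector_derivative[OF contb]) (use 3 in auto)
      moreover have "at t within {-1..2} = at t"
        using 3 by (intro at_within_interior) auto
      ultimately show ?thesis
        by (simp add: has_real_derivative_iff_has_vector_derivative)
    qed
  qed
  have dR: "(R has_field_derivative R' t) (at t)" for t
    unfolding R_def R' using DERIV_cdivide[OF dI[of t], of c] by simp
  show ?thesis
  proof (rule that[of R R' "insert R {bump P k | P k. True}"])
    show "\<And>t. R t \<le> 1"
    proof -
      fix t show "R t \<le> 1"
        using c mono[of t 1] I1[of t] by (cases "t \<le> 1") (simp_all add: R_def flip: c_def)
    qed
    show "\<And>t. 0 \<le> R t"
    proof -
      fix t show "0 \<le> R t"
        using c mono[of 0 t] I0[of 0] I0[of t] by (cases "t \<le> 0") (auto simp: R_def)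
    qed
    show "\<And>g. g \<in> insert R {bump P k | P k. True} \<Longrightarrow>
        \<exists>g'\<in>insert R {bump P k | P k. True}. \<forall>x. (g has_field_derivative g' x) (at x)"
    proof -
      fix g assume "g \<in> insert R {bump P k | P k. True}"
      then consider "g = R" | P k where "g = bump P k" by blast
      then show "\<exists>g'\<in>insert R {bump P k | P k. True}. \<forall>x. (g has_field_derivative g' x) (at x)"
      proof cases
        case 1
        then show ?thesis using dR unfolding R'_def by blast
      next
        case 2
        then show ?thesis using bump_has_field_derivative[of P k] by blast
      qed
    qed
    show "continuous_on UNIV R'" unfolding R'_def by (rule continuous_on_bump)
    show "\<And>t. t \<ge> 1 \<Longrightarrow> R t = 1" using c unfolding R_def c_def by (subst I1) auto
    show "\<And>t. R' t \<ge> 0" using c by (simp add: R' b)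
    show "\<And>t. t \<notin> {0..1} \<Longrightarrow> R' t = 0" by (auto simp: R' b)
  qed (use dR in \<open>auto simp: I0 R_def\<close>)
qed

text \<open>A smoothed indicator of an interval: it rises on \<open>{x..x + 1 / m}\<close> and, when
  the two ramps are disjoint, falls on \<open>{y..y + 1 / m}\<close>. Both steps have reached 1
  beyond \<open>y + 1 / m\<close>, which is why the support stays inside (0,1).\<close>

lemma test_function_step_difference:
  assumes R: "R \<in> \<F>" "\<And>g. g \<in> \<F> \<Longrightarrow> \<exists>g'\<in>\<F>. \<forall>x. (g has_field_derivative g' x) (at x)"
    and R0: "\<And>t. t \<le> 0 \<Longrightarrow> R t = 0" and R1: "\<And>t. t \<ge> 1 \<Longrightarrow> R t = 1"
    and m: "m > 0" "0 < x" "x \<le> y" "y + 1 / m < 1"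
  shows "test_function (\<lambda>t. R (m * (t - x)) - R (m * (t - y)))"
  unfolding test_function_def
proof (intro conjI allI)
  fix n s
  \<comment> \<open>Each differentiation brings out a factor \<open>m\<close> by the chain rule; the
    free coefficient \<open>c\<close> absorbs it.\<close>
  define \<G> where "\<G> = {(\<lambda>t. c * (u (m * (t - x)) - u (m * (t - y)))) | c u. u \<in> \<F>}"
  show "((deriv ^^ n) (\<lambda>t. R (m * (t - x)) - R (m * (t - y)))) field_differentiable (at s)"
  proof (rule all_derivs_differentiableI[of _ \<G>])
    show "(\<lambda>t. R (m * (t - x)) - R (m * (t - y))) \<in> \<G>"
      unfolding \<G>_def using R(1) by (auto intro!: exI[of _ 1])
    fix g assume "g \<in> \<G>"
    then obtain c u where g: "g = (\<lambda>t. c * (u (m * (t - x)) - u (m * (t - y))))" "u \<in> \<F>"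
      unfolding \<G>_def by blast
    obtain u' where u': "u' \<in> \<F>" "\<And>x. (u has_field_derivative u' x) (at x)" using R(2)[OF g(2)] by blast
    have "(g has_field_derivative ((c * m) * (u' (m * (t - x)) - u' (m * (t - y))))) (at t)" for t
      unfolding g(1)
      by (auto intro!: derivative_eq_intros DERIV_chain2[OF u'(2)] simp: algebra_simps)
    moreover have "(\<lambda>t. (c * m) * (u' (m * (t - x)) - u' (m * (t - y)))) \<in> \<G>"
      unfolding \<G>_def using u'(1) by blast
    ultimately show "\<exists>g'\<in>\<G>. \<forall>x. (g has_field_derivative g' x) (at x)"
      by (intro bexI[of _ "\<lambda>t. (c * m) * (u' (m * (t - x)) - u' (m * (t - y)))"]) auto
  qed
next
  show "\<exists>a b. 0 < a \<and> b < 1 \<and> (\<forall>t. t \<notin> {a..b} \<longrightarrow> R (m * (t - x)) - R (m * (t - y)) = 0)"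
  proof (rule exI[of _ x], rule exI[of _ "y + 1 / m"], intro conjI allI impI m)
    fix t assume "t \<notin> {x..y + 1 / m}"
    then consider "t < x" | "t > y + 1 / m" by fastforce
    then show "R (m * (t - x)) - R (m * (t - y)) = 0"
    proof cases
      case 1
      then show ?thesis using m by (simp add: R0 mult_nonneg_nonpos)
    next
      case 2
      then have "m * (t - y) \<ge> 1" using m by (simp add: field_simps)
      moreover have "m * (t - x) \<ge> m * (t - y)" using m by (intro mult_left_mono) auto
      ultimately show ?thesis by (simp add: R1)
    qed
  qed
qed

section \<open>The lemma of du Bois-Reymond\<close>

lemma integrable_unit_interval_iff:
  fixes f :: "real \<Rightarrow> 'a::euclidean_space"
  shows "integrable unit_interval f \<longleftrightarrow> f absolutely_integrable_on {0..1}"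
  unfolding absolutely_integrable_on_Icc_iff_Ioo
  by (simp add: integrable_restrict_space set_integrable_def)

lemma integral_unit_interval:
  fixes f :: "real \<Rightarrow> 'a::euclidean_space"
  assumes "f absolutely_integrable_on {0..1}"
  shows "integral\<^sup>L unit_interval f = integral {0..1} f"
  using assms lebesgue_integral_eq_integral[of "{0<..<1}" f]
  by (simp add: integrable_unit_interval_iff integral_open_interval_real)

lemma continuous_on_measurable_unit_interval:
  fixes f :: "real \<Rightarrow> 'a::euclidean_space"
  assumes "continuous_on {0..1} f"
  shows "f \<in> borel_measurable unit_interval"
  by (rule continuous_imp_measurable_on_sets_lebesgue)
     (auto intro: continuous_on_subset[OF assms])

lemma test_functionE:
  assumes "test_function \<psi>"
  shows "(\<psi> has_field_derivative deriv \<psi> t) (at t)"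
    and "(deriv \<psi> has_field_derivative (deriv ^^ 2) \<psi> t) (at t)"
    and "continuous_on S \<psi>" and "continuous_on S (deriv \<psi>)" and "continuous_on S ((deriv ^^ 2) \<psi>)"
    and "\<psi> 0 = 0" and "\<psi> 1 = 0" and "deriv \<psi> 0 = 0" and "deriv \<psi> 1 = 0"
proof -
  have d: "((deriv ^^ n) \<psi>) field_differentiable (at x)" for n x
    using assms by (simp add: test_function_def)
  show d1: "(\<psi> has_field_derivative deriv \<psi> t) (at t)" for t
    using d[of 0 t] by (simp add: DERIV_deriv_iff_field_differentiable)
  show d2: "(deriv \<psi> has_field_derivative (deriv ^^ 2) \<psi> t) (at t)" for t
    using d[of 1 t] by (simp add: DERIV_deriv_iff_field_differentiable numeral_2_eq_2)
  have c: "continuous_on S ((deriv ^^ n) \<psi>)" for n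
    using d by (intro continuous_at_imp_continuous_on) (auto intro: field_differentiable_imp_continuous_at)
  show "continuous_on S \<psi>" "continuous_on S (deriv \<psi>)" "continuous_on S ((deriv ^^ 2) \<psi>)"
    using c[of 0] c[of 1] c[of 2] by simp_all
  obtain a b where ab: "0 < a" "b < 1" "\<And>x. x \<notin> {a..b} \<Longrightarrow> \<psi> x = 0"
    using assms by (auto simp: test_function_def)
  show "\<psi> 0 = 0" "\<psi> 1 = 0" using ab by auto
  have zero: "((\<lambda>_. 0) has_field_derivative 0) (at t)" for t :: real by simp
  have "(\<psi> has_field_derivative 0) (at 0)"
    by (rule has_field_derivative_transform_within_open[OF zero, where S = "{..<a}"])
       (use ab in auto)
  then show "deriv \<psi> 0 = 0" by (rule DERIV_imp_deriv)
  have "(\<psi> has_field_derivative 0) (at 1)"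
    by (rule has_field_derivative_transform_within_open[OF zero, where S = "{b<..}"])
       (use ab in auto)
  then show "deriv \<psi> 1 = 0" by (rule DERIV_imp_deriv)
qed

text \<open>Only one derivative is moved, because \<open>p\<close> is merely continuous here. The
  integral of \<open>deriv \<psi> x *\<^sub>R p x\<close> is the meeting point for both directions
  between weak derivatives and primitives; the boundary terms vanish with
  \<open>deriv \<psi>\<close> at 0 and 1.\<close>

lemma integral_test_function_deriv2:
  fixes f F :: "real \<Rightarrow> 'a::euclidean_space"
  assumes \<psi>: "test_function \<psi>" and f: "f \<in> borel_measurable unit_interval"
    and ae: "AE x in unit_interval. f x = F x"
    and F: "\<And>x. x \<in> {0..1} \<Longrightarrow> (F has_vector_derivative p x) (at x within {0..1})"
    and p: "continuous_on {0..1} p"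
  shows "(LINT x|unit_interval. (deriv ^^ 2) \<psi> x *\<^sub>R f x) = - integral {0..1} (\<lambda>x. deriv \<psi> x *\<^sub>R p x)"
proof -
  note T = test_functionE[OF \<psi>]
  have cF: "continuous_on {0..1} F" by (rule continuous_on_vector_derivative[OF F])
  have [measurable]: "F \<in> borel_measurable unit_interval" "f \<in> borel_measurable unit_interval"
      "(deriv ^^ 2) \<psi> \<in> borel_measurable unit_interval"
    using f T(5) cF by (auto intro: continuous_on_measurable_unit_interval)
  have "(LINT x|unit_interval. (deriv ^^ 2) \<psi> x *\<^sub>R f x) = (LINT x|unit_interval. (deriv ^^ 2) \<psi> x *\<^sub>R F x)"
    by (rule integral_cong_AE) (use ae in auto)
  also have "\<dots> = integral {0..1} (\<lambda>x. (deriv ^^ 2) \<psi> x *\<^sub>R F x)"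
    by (intro integral_unit_interval absolutely_integrable_continuous_real continuous_intros T cF)
  also have "\<dots> = deriv \<psi> 1 *\<^sub>R F 1 - deriv \<psi> 0 *\<^sub>R F 0 - integral {0..1} (\<lambda>x. deriv \<psi> x *\<^sub>R p x)"
  proof (intro integral_unique integration_by_parts_indefinite bounded_bilinear_scaleR F p)
    show "(deriv ^^ 2) \<psi> absolutely_integrable_on {0..1}"
      by (intro absolutely_integrable_continuous_real T)
    fix x :: real assume "x \<in> {0..1}"
    then show "((deriv ^^ 2) \<psi> has_integral deriv \<psi> x - deriv \<psi> 0) {0..x}"
      by (intro fundamental_theorem_of_calculus)
         (auto simp flip: has_real_derivative_iff_has_vector_derivative intro: has_field_derivative_at_within T)
  qed auto
  finally show ?thesis by (simp add: T)
qed

text \<open>Both sides reduce to minus the integral of \<open>deriv \<psi> x *\<^sub>R p x\<close>: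
  one by moving a derivative from \<open>\<psi>\<close> to \<open>F\<close>, the other by moving one
  from \<open>p\<close> to \<open>\<psi>\<close>.\<close>

lemma generalized_deriv2_of_primitive:
  assumes "f \<in> borel_measurable unit_interval" "AE x in unit_interval. f x = F x"
    and F: "second_order_primitive F p h"
  shows "generalized_deriv 2 f h"
  unfolding generalized_deriv_def
proof (intro allI impI)
  fix \<psi> assume \<psi>: "test_function \<psi>"
  note T = test_functionE[OF \<psi>]
  note cp = second_order_primitive_continuous(2)[OF F]
  have habs: "h absolutely_integrable_on {0..1}" using F by (simp add: second_order_primitive_def)
  have 1: "(\<lambda>x. \<psi> x *\<^sub>R h x) absolutely_integrable_on {0..1}"
    by (rule absolutely_integrable_bilinear_continuous[OF bounded_bilinear.flip[OF bounded_bilinear_scaleR] habs T(3)])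
  have "((\<lambda>x. \<psi> x *\<^sub>R h x) has_integral
          (\<psi> 1 *\<^sub>R p 1 - \<psi> 0 *\<^sub>R p 0 - integral {0..1} (\<lambda>x. deriv \<psi> x *\<^sub>R p x))) {0..1}"
    by (rule integration_by_parts_indefinite[OF bounded_bilinear.flip[OF bounded_bilinear_scaleR]])
       (use F T in \<open>auto simp: second_order_primitive_def simp flip: has_real_derivative_iff_has_vector_derivative
          intro: has_field_derivative_at_within\<close>)
  then have "(LINT x|unit_interval. \<psi> x *\<^sub>R h x) = - integral {0..1} (\<lambda>x. deriv \<psi> x *\<^sub>R p x)"
    using integral_unit_interval[OF 1] by (simp add: T integral_unique)
  moreover have "(LINT x|unit_interval. (deriv ^^ 2) \<psi> x *\<^sub>R f x) = - integral {0..1} (\<lambda>x. deriv \<psi> x *\<^sub>R p x)"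
    using F by (intro integral_test_function_deriv2[OF \<psi> assms(1,2) _ cp]) (auto simp: second_order_primitive_def)
  ultimately show "(LINT x|unit_interval. (deriv ^^ 2) \<psi> x *\<^sub>R f x) =
      (- 1) ^ 2 *\<^sub>R (LINT x|unit_interval. \<psi> x *\<^sub>R h x)" by simp
qed

text \<open>The weights n R'(n(t - x)) form a one-sided approximate identity: nonnegative, supported
  in [x, x + 1/n], and of mass 1 on [0,1] once 1/n < 1 - x. Taking also 1/n < d confines the
  integral to points where \<open>G\<close> is within r/2 of \<open>G x\<close>.\<close>

lemma smooth_step_deriv_approximates_point:
  fixes G :: "real \<Rightarrow> 'a::euclidean_space"
  assumes R0: "\<And>t. t \<le> 0 \<Longrightarrow> R t = 0" and R1: "\<And>t. t \<ge> 1 \<Longrightarrow> R t = 1"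
    and dR: "\<And>t. (R has_field_derivative R' t) (at t)" and R': "\<And>t. R' t \<ge> (0::real)"
    and R'0: "\<And>t. t \<notin> {0..1} \<Longrightarrow> R' t = 0" and cR': "continuous_on UNIV R'"
    and G: "continuous_on {0..1} G" and x: "0 < x" "x < 1"
  shows "(\<lambda>n. integral {0..1} (\<lambda>t. (real n * R' (real n * (t - x))) *\<^sub>R G t)) \<longlonglongrightarrow> G x"
proof (rule LIMSEQ_I)
  fix r :: real assume r: "r > 0"
  obtain d where d: "d > 0" "\<And>t. t \<in> {0..1} \<Longrightarrow> dist t x < d \<Longrightarrow> dist (G t) (G x) < r / 2"
    using G x r unfolding continuous_on_iff by (metis atLeastAtMost_iff half_gt_zero less_imp_le)
  obtain N where N: "real N > max (1 / d) (1 / (1 - x))" using reals_Archimedean2 by blast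
  show "\<exists>no. \<forall>n\<ge>no. norm (integral {0..1} (\<lambda>t. (real n * R' (real n * (t - x))) *\<^sub>R G t) - G x) < r"
  proof (intro exI[of _ N] allI impI)
    fix n assume "n \<ge> N"
    then have "real n > max (1 / d) (1 / (1 - x))" using N by linarith
    then have n: "real n > 1 / d" "real n > 1 / (1 - x)" "real n > 0"
      using d(1) less_trans[of 0 "1 / d" "real n"] by auto
    define w where "w t = real n * R' (real n * (t - x))" for t
    have cw: "continuous_on S w" for S
      unfolding w_def by (intro continuous_intros continuous_on_compose2[OF cR']) auto
    have iw: "(w has_integral 1) {0..1}"
    proof -
      have "(w has_integral (R (real n * (1 - x)) - R (real n * (0 - x)))) {0..1}"
      proof (rule fundamental_theorem_of_calculus)
        fix t
        have "((\<lambda>t. R (real n * (t - x))) has_field_derivative w t) (at t)"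
          unfolding w_def by (rule DERIV_cong[OF DERIV_chain2[OF dR]]) (auto intro!: derivative_eq_intros)
        then show "((\<lambda>t. R (real n * (t - x))) has_vector_derivative w t) (at t within {0..1})"
          by (simp add: has_field_derivative_at_within flip: has_real_derivative_iff_has_vector_derivative)
      qed simp
      moreover have "R (real n * (1 - x)) = 1" using n x by (intro R1) (simp add: field_simps)
      moreover have "R (real n * (0 - x)) = 0" using n x by (intro R0) (simp add: mult_nonneg_nonpos)
      ultimately show ?thesis by simp
    qed
    have "((\<lambda>t. w t *\<^sub>R G t - w t *\<^sub>R G x) has_integral (integral {0..1} (\<lambda>t. w t *\<^sub>R G t) - 1 *\<^sub>R G x)) {0..1}"
      by (intro has_integral_diff integrable_integral integrable_continuous_real continuous_intros cw G
          has_integral_scaleR_left iw)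
    then have "integral {0..1} (\<lambda>t. w t *\<^sub>R G t) - G x = integral {0..1} (\<lambda>t. w t *\<^sub>R (G t - G x))"
      by (simp add: integral_unique scaleR_diff_right)
    also have "norm \<dots> \<le> integral {0..1} (\<lambda>t. w t * (r / 2))"
    proof (rule integral_norm_bound_integral)
      fix t :: real assume t: "t \<in> {0..1}"
      show "norm (w t *\<^sub>R (G t - G x)) \<le> w t * (r / 2)"
      proof (cases "w t = 0")
        case False
        then have "real n * (t - x) \<in> {0..1}" using R'0 by (force simp: w_def)
        then have "0 \<le> t - x" "t - x \<le> 1 / real n" using n by (auto simp: field_simps zero_le_mult_iff)
        moreover have "1 / real n < d" using n d by (simp add: field_simps)
        ultimately have "dist t x < d" by (simp add: dist_real_def)
        then have "norm (G t - G x) \<le> r / 2" using d(2)[OF t] by (simp add: dist_norm)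
        moreover have "w t \<ge> 0" using n R' by (simp add: w_def)
        ultimately show ?thesis using mult_left_mono[of "norm (G t - G x)" "r / 2" "w t"] by simp
      qed simp
    qed (intro integrable_continuous_real continuous_intros cw G)+
    also have "\<dots> = r / 2" using iw by (simp add: integral_unique)
    also have "\<dots> < r" using r by simp
    finally show "norm (integral {0..1} (\<lambda>t. (real n * R' (real n * (t - x))) *\<^sub>R G t) - G x) < r"
      by (simp add: w_def)
  qed
qed

lemma smooth_step_tendsto:
  fixes R :: "real \<Rightarrow> real"
  assumes "\<And>t. t \<le> 0 \<Longrightarrow> R t = 0" "\<And>t. t \<ge> 1 \<Longrightarrow> R t = 1"
  shows "(\<lambda>n. R (real n * (t - x))) \<longlonglongrightarrow> indicator {x<..} t"
proof (cases "t > x")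
  case True
  obtain N where N: "real N > 1 / (t - x)" using reals_Archimedean2 by blast
  have "R (real n * (t - x)) = 1" if "n \<ge> N" for n
  proof -
    have "real n > 1 / (t - x)" using N that by linarith
    then show ?thesis using True by (intro assms) (simp add: field_simps)
  qed
  then have "\<forall>\<^sub>F n in sequentially. R (real n * (t - x)) = 1"
    by (auto simp: eventually_sequentially)
  then show ?thesis using True by (simp add: tendsto_eventually)
next
  case False
  then have "R (real n * (t - x)) = 0" for n by (intro assms) (simp add: mult_nonneg_nonpos)
  then show ?thesis using False by simp
qed

text \<open>For smoothed indicators of (x,y], the side with \<open>p\<close> is a difference of two
  approximate identities and tends to \<open>p y - p x\<close>, while the side with \<open>h\<close>
  tends to the integral of \<open>h\<close> by dominated convergence. This needs 0 < x <= y < 1, as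
  test functions vanish near the end points; continuity carries the result to [0,1].\<close>

lemma generalized_deriv2_imp_primitive:
  assumes f: "f \<in> borel_measurable unit_interval" and h: "h absolutely_integrable_on {0..1}"
    and gd: "generalized_deriv 2 f h" and rep: "C1_representative f F p"
  shows "second_order_primitive F p h"
proof -
  have ae: "AE x in unit_interval. f x = F x"
    and dF: "\<And>x. x \<in> {0..1} \<Longrightarrow> (F has_vector_derivative p x) (at x within {0..1})"
    and cp: "continuous_on {0..1} p"
    using rep by (auto simp: C1_representative_def)
  obtain R R' :: "real \<Rightarrow> real" and \<F> where
    R0: "\<And>t. t \<le> 0 \<Longrightarrow> R t = 0" and R1: "\<And>t. t \<ge> 1 \<Longrightarrow> R t = 1" and Rge: "\<And>t. 0 \<le> R t" "\<And>t. R t \<le> 1" and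
    dR: "\<And>t. (R has_field_derivative R' t) (at t)" and R': "\<And>t. R' t \<ge> 0"
    "\<And>t. t \<notin> {0..1} \<Longrightarrow> R' t = 0" "continuous_on UNIV R'" and
    RF: "R \<in> \<F>" "\<And>g. g \<in> \<F> \<Longrightarrow> \<exists>g'\<in>\<F>. \<forall>x. (g has_field_derivative g' x) (at x)"
    using exists_smooth_step by blast
  have hI: "integrable unit_interval h" using h by (simp add: integrable_unit_interval_iff)
  have cR: "continuous_on S R" for S
    using dR by (meson DERIV_isCont continuous_at_imp_continuous_on)
  have key: "(h has_integral (p y - p x)) {x..y}" if x: "0 < x" "x \<le> y" "y < 1" for x y
  proof -
    define \<psi> where "\<psi> n t = R (real n * (t - x)) - R (real n * (t - y))" for n :: nat and t
    define J where "J n z = integral {0..1} (\<lambda>t. (real n * R' (real n * (t - z))) *\<^sub>R p t)" for n :: nat and z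
    \<comment> \<open>For \<open>n \<ge> N\<close> the falling ramp ends at
      \<open>y + 1 / n < 1\<close>, so \<open>\<psi> n\<close> is an admissible test
      function.\<close>
    obtain N where N: "real N > 1 / (1 - y)" using reals_Archimedean2 by blast
    have eq: "(LINT t|unit_interval. \<psi> n t *\<^sub>R h t) = J n y - J n x" if "n \<ge> N" for n
    proof -
      have n: "real n > 1 / (1 - y)" using N that by linarith
      then have n0: "real n > 0" using x less_trans[of 0 "1 / (1 - y)" "real n"] by auto
      have T: "test_function (\<psi> n)"
        unfolding \<psi>_def by (rule test_function_step_difference[OF RF R0 R1]) (use n n0 x in \<open>auto simp: field_simps\<close>)
      have "(\<psi> n has_field_derivative (real n * R' (real n * (t - x)) - real n * R' (real n * (t - y)))) (at t)" for t
        unfolding \<psi>_def by (auto intro!: derivative_eq_intros DERIV_chain2[OF dR])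
      then have d: "deriv (\<psi> n) t = real n * R' (real n * (t - x)) - real n * R' (real n * (t - y))" for t
        by (rule DERIV_imp_deriv)
      have "(LINT t|unit_interval. \<psi> n t *\<^sub>R h t) = - integral {0..1} (\<lambda>t. deriv (\<psi> n) t *\<^sub>R p t)"
        using gd[unfolded generalized_deriv_def, rule_format, OF T]
          integral_test_function_deriv2[OF T f ae dF cp] by simp
      also have "\<dots> = - (J n x - J n y)"
        unfolding d scaleR_diff_left J_def
        by (subst Henstock_Kurzweil_Integration.integral_diff)
          (auto intro!: integrable_continuous_real continuous_intros cp continuous_on_compose2[OF R'(3)])
      finally show ?thesis by simp
    qed
    have "(\<lambda>n. J n y - J n x) \<longlonglongrightarrow> p y - p x"
      unfolding J_def using x
      by (intro tendsto_diff smooth_step_deriv_approximates_point[OF R0 R1 dR R' cp]) auto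
    then have lim1: "(\<lambda>n. LINT t|unit_interval. \<psi> n t *\<^sub>R h t) \<longlonglongrightarrow> p y - p x"
      by (rule Lim_transform_eventually) (auto simp: eventually_sequentially intro!: exI[of _ N] eq[symmetric])
    have ind: "(\<lambda>t. (indicator {x<..} t - indicator {y<..} t) *\<^sub>R h t) \<in> borel_measurable unit_interval"
    proof -
      have "(\<lambda>t. indicator {z<..} t :: real) \<in> borel_measurable unit_interval" for z :: real
        by (rule borel_measurable_indicator') (auto simp: sets_restrict_space intro!: image_eqI[of _ _ "{z<..}"])
      then show ?thesis using hI by (intro borel_measurable_scaleR borel_measurable_diff) auto
    qed
    have lim2: "(\<lambda>n. LINT t|unit_interval. \<psi> n t *\<^sub>R h t) \<longlonglongrightarrow>
        (LINT t|unit_interval. (indicator {x<..} t - indicator {y<..} t) *\<^sub>R h t)"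
    proof (rule integral_dominated_convergence)
      show "integrable unit_interval (\<lambda>t. norm (h t))" using hI by simp
      show "(\<lambda>t. (indicator {x<..} t - indicator {y<..} t) *\<^sub>R h t) \<in> borel_measurable unit_interval"
        by (rule ind)
      fix n
      have "\<psi> n \<in> borel_measurable unit_interval"
        unfolding \<psi>_def
        by (intro continuous_on_measurable_unit_interval continuous_intros continuous_on_compose2[OF cR[of UNIV]]) auto
      then show "(\<lambda>t. \<psi> n t *\<^sub>R h t) \<in> borel_measurable unit_interval"
        using hI by (intro borel_measurable_scaleR) auto
      show "AE t in unit_interval. norm (\<psi> n t *\<^sub>R h t) \<le> norm (h t)"
      proof (rule AE_I2)
        fix t
        have "\<bar>\<psi> n t\<bar> \<le> 1" using Rge[of "real n * (t - x)"] Rge[of "real n * (t - y)"] by (simp add: \<psi>_def)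
        then show "norm (\<psi> n t *\<^sub>R h t) \<le> norm (h t)" by (simp add: mult_left_le_one_le)
      qed
    next
      show "AE t in unit_interval. (\<lambda>n. \<psi> n t *\<^sub>R h t) \<longlonglongrightarrow> (indicator {x<..} t - indicator {y<..} t) *\<^sub>R h t"
        unfolding \<psi>_def by (intro AE_I2 tendsto_intros smooth_step_tendsto R0 R1)
    qed
    have hxy: "h absolutely_integrable_on {x..y}"
      using x by (intro absolutely_integrable_on_subinterval[OF h]) auto
    then have "(h has_integral integral {x..y} h) {x..y}"
      by (simp add: absolutely_integrable_on_def integrable_integral)
    moreover have "(LINT t|unit_interval. (indicator {x<..} t - indicator {y<..} t) *\<^sub>R h t) = integral {x..y} h"
    proof -
      \<comment> \<open>The pointwise limit is the indicator of the half-open interval (x,y], which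
        differs from that of \<open>{x..y}\<close> only at \<open>x\<close>.\<close>
      have neg: "negligible {x}" by simp
      have 1: "((\<lambda>t. if t \<in> {x..y} then h t else 0) has_integral integral {x..y} h) {0..1}"
        using x calculation by (subst has_integral_restrict) auto
      have 2: "((\<lambda>t. (indicator {x<..} t - indicator {y<..} t) *\<^sub>R h t) has_integral integral {x..y} h) {0..1}"
        by (rule has_integral_spike[OF neg _ 1]) (use x in \<open>auto simp: indicator_def\<close>)
      have "integrable unit_interval (\<lambda>t. (indicator {x<..} t - indicator {y<..} t) *\<^sub>R h t)"
        by (rule Bochner_Integration.integrable_bound[OF hI])
           (rule ind, auto simp: indicator_def)
      then show ?thesis using 2
        by (subst integral_unit_interval) (auto simp: integrable_unit_interval_iff integral_unique)
    qed
    ultimately show ?thesis using LIMSEQ_unique[OF lim1 lim2] by simp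
  qed
  have hint: "h integrable_on {0..1}" using h by (simp add: absolutely_integrable_on_def)
  \<comment> \<open>The interior identity says that \<open>K\<close> is constant on (0,1). Being
    continuous on [0,1], it keeps that value at 0, and \<open>K x = K 0\<close> is the
    claim.\<close>
  define K where "K x = p x - integral {0..x} h" for x
  have cK: "continuous_on {0..1} K"
    unfolding K_def by (intro continuous_intros cp indefinite_integral_continuous_1 hint)
  have K_const: "K x = K (1/2)" if x: "x \<in> {0<..<1}" for x
  proof -
    have "K u = K v" if "0 < u" "u \<le> v" "v < 1" for u v
    proof -
      have "integral {0..u} h + integral {u..v} h = integral {0..v} h"
        using that by (intro Henstock_Kurzweil_Integration.integral_combine integrable_on_subinterval[OF hint]) auto
      then show ?thesis using key[OF that] by (auto simp: K_def integral_unique algebra_simps)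
    qed
    from this[of x "1/2"] this[of "1/2" x] x show ?thesis by (cases "x \<le> 1/2") auto
  qed
  have K_all: "K x = K (1/2)" if "x \<in> {0..1}" for x
  proof (rule continuous_constant_on_closure[of "{0<..<1}" K])
    show "continuous_on (closure {0<..<1}) K" using cK by simp
    show "x \<in> closure {0<..<1}" using that by simp
  qed (rule K_const)
  have "(h has_integral (p x - p 0)) {0..x}" if x: "x \<in> {0..1}" for x
  proof -
    have "integral {0..x} h = p x - p 0"
      using trans[OF K_all[OF x] K_all[of 0, symmetric]] by (simp add: K_def algebra_simps)
    moreover have "h integrable_on {0..x}" using x by (intro integrable_on_subinterval[OF hint]) auto
    ultimately show ?thesis by (metis integrable_integral)
  qed
  then show ?thesis using h dF by (simp add: second_order_primitive_def)
qed

section \<open>The graph of the operator and its domain\<close>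

lemma bounded_linear_matrix_vector_mult:
  "bounded_linear ((*v) (A :: complex^'n^'m))"
  by (intro linear_conv_bounded_linear[THEN iffD1] linearI)
     (simp_all add: matrix_vector_mult_def vec_eq_iff scaleR_sum_right sum.distrib algebra_simps)

lemma matrix_vector_mult_uminus [simp]: "(A :: complex^'n^'m) *v (- x) = - (A *v x)"
  by (simp add: matrix_vector_mult_def vec_eq_iff sum_negf)

section \<open>The pointwise Hermitian form and closure properties of square-integrable
  functions\<close>

definition cinner :: "complex^'n \<Rightarrow> complex^'n \<Rightarrow> complex" where
  "cinner x y = (\<Sum>i\<in>UNIV. x $ i * cnj (y $ i))"

lemma bounded_bilinear_cinner: "bounded_bilinear (cinner :: complex^'n \<Rightarrow> complex^'n \<Rightarrow> complex)"
proof
  fix a a' b b' :: "complex^'n" and r :: real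
  show "cinner (a + a') b = cinner a b + cinner a' b" "cinner a (b + b') = cinner a b + cinner a b'"
    by (simp_all add: cinner_def algebra_simps sum.distrib)
  show "cinner (r *\<^sub>R a) b = r *\<^sub>R cinner a b" "cinner a (r *\<^sub>R b) = r *\<^sub>R cinner a b"
    by (simp_all add: cinner_def scaleR_sum_right)
next
  have "norm (cinner a b) \<le> norm a * norm b * real CARD('n)" for a b :: "complex^'n"
  proof -
    have "norm (cinner a b) \<le> (\<Sum>i\<in>(UNIV::'n set). norm a * norm b)"
      unfolding cinner_def
      by (rule sum_norm_le) (auto simp: norm_mult intro!: mult_mono Finite_Cartesian_Product.norm_nth_le)
    then show ?thesis by (simp add: mult.commute)
  qed
  then show "\<exists>K. \<forall>a b. norm (cinner a b :: complex) \<le> norm (a :: complex^'n) * norm b * K" by blast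
qed

lemma cinner_self: "cinner x x = of_real ((norm x)\<^sup>2)"
proof -
  have "(norm x)\<^sup>2 = (\<Sum>i\<in>UNIV. (norm (x $ i))\<^sup>2)"
    by (simp add: norm_vec_def L2_set_def sum_nonneg)
  then show ?thesis by (simp only: cinner_def of_real_sum complex_norm_square)
qed

interpretation cinner: bounded_bilinear "cinner :: complex^2 \<Rightarrow> complex^2 \<Rightarrow> complex"
  by (rule bounded_bilinear_cinner)

lemma L2_inner_cinner: "L2_inner f g = (LINT x|unit_interval. cinner (f x) (g x))"
  by (simp add: L2_inner_def cinner_def)

lemma finite_measure_unit_interval: "finite_measure unit_interval"
  by (rule finite_measure_lebesgue_on) simp

lemma integrable_const_unit_interval [simp]: "integrable unit_interval (\<lambda>_. c)"
  by (rule finite_measure.integrable_const[OF finite_measure_unit_interval])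

lemma L2_measurable: "f \<in> L2 \<Longrightarrow> f \<in> borel_measurable unit_interval"
  by (simp add: L2_def)

lemma L2_integrable:
  assumes "f \<in> L2" shows "f absolutely_integrable_on {0..1}"
proof -
  have "norm (f x) \<le> norm (1 + (norm (f x))\<^sup>2)" for x
    using sum_squares_bound[of "norm (f x)" 1] by simp (smt (verit) norm_ge_zero)
  then have "integrable unit_interval f"
    by (intro Bochner_Integration.integrable_bound[where f = "\<lambda>x. 1 + (norm (f x))\<^sup>2" and g = f] AE_I2)
      (use assms in \<open>simp_all add: L2_def\<close>)
  then show ?thesis by (simp add: integrable_unit_interval_iff)
qed

lemma L2_boundedI:
  assumes "f \<in> borel_measurable unit_interval" "\<And>x. x \<in> {0<..<1} \<Longrightarrow> norm (f x) \<le> B"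
  shows "f \<in> L2"
  unfolding L2_def
proof (safe intro!: assms(1))
  show "integrable unit_interval (\<lambda>x. (norm (f x))\<^sup>2)"
  proof (rule Bochner_Integration.integrable_bound[where f = "\<lambda>_. B\<^sup>2"])
    show "(\<lambda>x. (norm (f x))\<^sup>2) \<in> borel_measurable unit_interval" using assms(1) by simp
    show "AE x in unit_interval. norm ((norm (f x))\<^sup>2) \<le> norm (B\<^sup>2)"
      by (rule AE_I2) (use assms(2) in \<open>auto intro!: power_mono\<close>)
  qed simp
qed

lemma L2_continuous:
  assumes "continuous_on {0..1} f" shows "f \<in> L2"
proof -
  obtain B where "\<And>x. x \<in> {0..1} \<Longrightarrow> norm (f x) \<le> B"
    using compact_imp_bounded[OF compact_continuous_image[OF assms compact_Icc]] unfolding bounded_iff by blast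
  then show ?thesis
    by (intro L2_boundedI[of _ B] continuous_on_measurable_unit_interval assms) auto
qed

lemma norm_diff_square_le:
  fixes a b :: "'a::real_normed_vector"
  shows "(norm (a - b))\<^sup>2 \<le> 2 * (norm a)\<^sup>2 + 2 * (norm b)\<^sup>2"
proof -
  have "(norm (a - b))\<^sup>2 \<le> (norm a + norm b)\<^sup>2" by (intro power_mono norm_triangle_ineq4) simp
  also have "\<dots> \<le> 2 * (norm a)\<^sup>2 + 2 * (norm b)\<^sup>2"
    using sum_squares_bound[of "norm a" "norm b"] by (simp add: power2_sum)
  finally show ?thesis .
qed

lemma L2_diff:
  assumes "f \<in> L2" "g \<in> L2" shows "(\<lambda>x. f x - g x) \<in> L2"
proof -
  have "integrable unit_interval (\<lambda>x. (norm (f x - g x))\<^sup>2)"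
    by (rule Bochner_Integration.integrable_bound[where f = "\<lambda>x. 2 * (norm (f x))\<^sup>2 + 2 * (norm (g x))\<^sup>2"])
       (use assms norm_diff_square_le[of "f _" "g _"] in \<open>auto simp: L2_def\<close>)
  then show ?thesis using assms by (auto simp: L2_def)
qed

lemma L2_bounded_linear:
  assumes "bounded_linear T" "f \<in> L2" shows "(\<lambda>x. T (f x)) \<in> L2"
proof -
  obtain K where K: "\<And>x. norm (T x) \<le> norm x * K" using bounded_linear.bounded[OF assms(1)] by blast
  have m: "(\<lambda>x. T (f x)) \<in> borel_measurable unit_interval"
    using L2_measurable[OF assms(2)] by (rule borel_measurable_continuous_on[OF linear_continuous_on[OF assms(1)]])
  have b: "(norm (T y))\<^sup>2 \<le> (norm y)\<^sup>2 * K\<^sup>2" for y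
    using power_mono[OF K[of y], of 2] by (simp add: power_mult_distrib)
  have "integrable unit_interval (\<lambda>x. (norm (T (f x)))\<^sup>2)"
    by (rule Bochner_Integration.integrable_bound[where f = "\<lambda>x. (norm (f x))\<^sup>2 * K\<^sup>2"])
       (use assms m b in \<open>auto simp: L2_def\<close>)
  with m show ?thesis by (simp add: L2_def)
qed

lemma L2_uminus: "f \<in> L2 \<Longrightarrow> (\<lambda>x. - f x) \<in> L2"
  by (simp add: L2_def)

lemma L2_matrix: "f \<in> L2 \<Longrightarrow> (\<lambda>x. A *v f x) \<in> L2"
  by (rule L2_bounded_linear[OF bounded_linear_matrix_vector_mult])

lemma cinner_measurable:
  assumes "f \<in> borel_measurable M" "g \<in> borel_measurable M"
  shows "(\<lambda>x. cinner (f x) (g x :: complex^2)) \<in> borel_measurable M"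
  by (rule borel_measurable_continuous_Pair[OF assms])
     (auto intro!: cinner.continuous_on continuous_intros)

lemma cinner_integrable:
  assumes "f \<in> L2" "g \<in> L2" shows "integrable unit_interval (\<lambda>x. cinner (f x) (g x))"
proof -
  obtain C where C: "\<And>x y :: complex^2. norm (cinner x y) \<le> norm x * norm y * C" "C \<ge> 0"
    using cinner.nonneg_bounded by blast
  have b: "norm (cinner x y) \<le> norm (((norm x)\<^sup>2 + (norm y)\<^sup>2) * C)" for x y :: "complex^2"
  proof -
    have "norm x * norm y \<le> (norm x)\<^sup>2 + (norm y)\<^sup>2"
      using sum_squares_bound[of "norm x" "norm y"]
        mult_nonneg_nonneg[OF norm_ge_zero[of x] norm_ge_zero[of y]] by linarith
    then have "norm x * norm y * C \<le> ((norm x)\<^sup>2 + (norm y)\<^sup>2) * C" using C(2) by (rule mult_right_mono)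
    then show ?thesis using C(1)[of x y] by simp
  qed
  show ?thesis
    by (rule Bochner_Integration.integrable_bound[where f = "\<lambda>x. ((norm (f x))\<^sup>2 + (norm (g x))\<^sup>2) * C"])
       (use assms b in \<open>auto simp: L2_def intro!: cinner_measurable\<close>)
qed

section \<open>Describing the graph without test functions\<close>

definition mixed_boundary :: "(real \<Rightarrow> complex^2) \<Rightarrow> (real \<Rightarrow> complex^2) \<Rightarrow> bool" where
  "mixed_boundary F p \<longleftrightarrow> F 0 $ 1 = 0 \<and> F 1 $ 1 = 0 \<and> p 0 $ 2 = 0 \<and> p 1 $ 2 = 0"

text \<open>In the definitions, the representative with its derivative and the weak second
  derivative \<open>h\<close> are independent witnesses. The lemma of du Bois-Reymond ties them
  together, and from here on generalized derivatives no longer occur.\<close>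

lemma matrix_op_D_op_iff:
  "(f, k) \<in> matrix_op A D_op \<longleftrightarrow> f \<in> L2 \<and> k \<in> L2 \<and>
    (\<exists>F p h. h \<in> L2 \<and> second_order_primitive F p h \<and> mixed_boundary F p \<and>
       (AE x in unit_interval. f x = F x) \<and> (AE x in unit_interval. k x = - (A *v h x)))"
proof
  assume "(f, k) \<in> matrix_op A D_op"
  then obtain g h F p where k: "k \<in> L2" "AE x in unit_interval. k x = A *v g x" and f: "f \<in> L2"
    and rep: "C1_representative f F p" and bc: "mixed_boundary F p"
    and h: "h \<in> L2" "generalized_deriv 2 f h" "AE x in unit_interval. g x = - h x"
    by (auto simp: matrix_op_def D_op_def Dom_D_def W22_def mixed_boundary_def)
  have "second_order_primitive F p h"
    by (rule generalized_deriv2_imp_primitive[OF L2_measurable[OF f] L2_integrable[OF h(1)] h(2) rep])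
  moreover have "AE x in unit_interval. k x = - (A *v h x)"
    using k(2) h(3)
  proof eventually_elim
    case (elim x)
    then show ?case
      by simp
  qed
  ultimately show "f \<in> L2 \<and> k \<in> L2 \<and>
    (\<exists>F p h. h \<in> L2 \<and> second_order_primitive F p h \<and> mixed_boundary F p \<and>
       (AE x in unit_interval. f x = F x) \<and> (AE x in unit_interval. k x = - (A *v h x)))"
    using f k bc rep h(1) unfolding C1_representative_def by blast
next
  assume "f \<in> L2 \<and> k \<in> L2 \<and>
    (\<exists>F p h. h \<in> L2 \<and> second_order_primitive F p h \<and> mixed_boundary F p \<and>
       (AE x in unit_interval. f x = F x) \<and> (AE x in unit_interval. k x = - (A *v h x)))"
  then obtain F p h where f: "f \<in> L2" and k: "k \<in> L2" and h: "h \<in> L2"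
    and s: "second_order_primitive F p h" and bc: "mixed_boundary F p"
    and ae: "AE x in unit_interval. f x = F x" "AE x in unit_interval. k x = - (A *v h x)" by blast
  have gd: "generalized_deriv 2 f h"
    by (rule generalized_deriv2_of_primitive[OF L2_measurable[OF f] ae(1) s])
  have "C1_representative f F p"
    using s ae(1) second_order_primitive_continuous(2)[OF s]
    by (auto simp: C1_representative_def second_order_primitive_def)
  then have "f \<in> Dom_D"
    using f h gd bc by (auto simp: Dom_D_def W22_def mixed_boundary_def)
  then have "(f, \<lambda>x. - h x) \<in> D_op"
    using h gd by (auto simp: D_op_def L2_uminus)
  moreover have "A *v (- h x) = - (A *v h x)" for x
    by simp
  ultimately show "(f, k) \<in> matrix_op A D_op"
    using k ae(2) unfolding matrix_op_def by auto
qed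

lemma matrix_op_D_opI:
  assumes "f \<in> L2" "k \<in> L2" "h \<in> L2" "second_order_primitive F p h" "mixed_boundary F p"
    "AE x in unit_interval. f x = F x" "AE x in unit_interval. k x = - (A *v h x)"
  shows "(f, k) \<in> matrix_op A D_op"
  using assms unfolding matrix_op_D_op_iff by blast

lemma C2_in_matrix_op_D_op:
  assumes F: "\<And>x. x \<in> {0..1} \<Longrightarrow> (F has_vector_derivative p x) (at x within {0..1})"
    and p: "\<And>x. x \<in> {0..1} \<Longrightarrow> (p has_vector_derivative h x) (at x within {0..1})"
    and h: "continuous_on {0..1} h" and bc: "mixed_boundary F p"
  shows "(F, \<lambda>x. - (A *v h x)) \<in> matrix_op A D_op"
proof -
  have "(h has_integral (p x - p 0)) {0..x}" if "x \<in> {0..1}" for x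
  proof (rule fundamental_theorem_of_calculus)
    fix s assume "s \<in> {0..x}"
    then show "(p has_vector_derivative h s) (at s within {0..x})"
      using that by (intro has_vector_derivative_within_subset[OF p]) auto
  qed (use that in auto)
  then have "second_order_primitive F p h"
    using F h by (simp add: second_order_primitive_def absolutely_integrable_continuous_real)
  moreover have "F \<in> L2" "h \<in> L2"
    using h continuous_on_vector_derivative[OF F] by (auto intro: L2_continuous)
  ultimately show ?thesis
    unfolding matrix_op_D_op_iff using bc by (auto intro: L2_uminus L2_matrix)
qed

section \<open>Density of the domain\<close>

text \<open>A double zero at each end makes \<open>\<eta> x *\<^sub>R q x\<close> and its derivative
  vanish there, so that all boundary conditions hold in both components. A bounded measurable
  \<open>f\<close> is an almost everywhere limit of continuous functions; these are clipped,
  approximated by polynomials within 1/(n+1), and cut off by \<open>\<eta> n\<close>, which tends to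
  1 on (0,1).\<close>

lemma L2_approx_polynomial:
  fixes f :: "real \<Rightarrow> complex^2"
  assumes f: "f \<in> borel_measurable unit_interval" and K: "K \<ge> 0" "\<And>x. norm (f x) \<le> K" and e: "e > 0"
  obtains \<eta> q where "real_polynomial_function \<eta>" "polynomial_function q" "\<eta> 0 = 0" "\<eta> 1 = 0"
    "(\<eta> has_field_derivative 0) (at 0)" "(\<eta> has_field_derivative 0) (at (1::real))"
    "(LINT x|unit_interval. (norm (f x - \<eta> x *\<^sub>R q x))\<^sup>2) < e"
proof -
  have "f measurable_on {0<..<1}"
    using f by (subst measurable_on_iff_borel_measurable) auto
  then obtain N g where N: "negligible N" and g: "\<And>n. continuous_on UNIV (g n)"
    and lim: "\<And>x. x \<notin> N \<Longrightarrow> (\<lambda>n. g n x) \<longlonglongrightarrow> (if x \<in> {0<..<1} then f x else 0)"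
    unfolding measurable_on_def by blast
  \<comment> \<open>Projecting to a ball keeps the continuous approximants dominated.\<close>
  define c where "c n x = closest_point (cball 0 K) (g n x)" for n :: nat and x
  have ccp: "continuous_on UNIV (closest_point (cball (0::complex^2) K))"
    using K(1) by (intro continuous_on_closest_point) auto
  have cK: "norm (c n x) \<le> K" for n x
    using closest_point_in_set[of "cball 0 K" "g n x"] K(1) by (simp add: c_def)
  have cc: "continuous_on {0..1} (c n)" for n
    unfolding c_def by (rule continuous_on_compose2[OF ccp continuous_on_subset[OF g]]) auto
  have clim: "(\<lambda>n. c n x) \<longlonglongrightarrow> f x" if "x \<notin> N" "x \<in> {0<..<1}" for x
  proof -
    have "isCont (closest_point (cball 0 K)) (f x)"
      using ccp by (simp add: continuous_on_eq_continuous_at)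
    then have "(\<lambda>n. closest_point (cball 0 K) (g n x)) \<longlonglongrightarrow> closest_point (cball 0 K) (f x)"
      by (rule isCont_tendsto_compose) (use lim[OF that(1)] that(2) in simp)
    moreover have "closest_point (cball 0 K) (f x) = f x"
      by (rule closest_point_self) (simp add: K)
    ultimately show ?thesis by (simp add: c_def)
  qed
  have "\<exists>q. polynomial_function q \<and> (\<forall>x\<in>{0..1}. norm (c n x - q x) < 1 / real (Suc n))" for n
    by (rule Stone_Weierstrass_polynomial_function[OF compact_Icc cc]) simp
  then obtain q where q: "\<And>n. polynomial_function (q n)"
      "\<And>n x. x \<in> {0..1} \<Longrightarrow> norm (c n x - q n x) < 1 / real (Suc n)" by metis
  \<comment> \<open>Polynomial cut-offs: \<open>1 - 4x(1 - x)\<close> lies in \<open>[0, 1)\<close> on \<open>(0, 1)\<close>, and the outer square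
     gives double zeros at the end points.\<close>
  define \<eta> where "\<eta> n x = (1 - (1 - 4 * x * (1 - x)) ^ n)\<^sup>2" for n :: nat and x :: real
  have s: "0 \<le> 1 - 4 * x * (1 - x)" for x :: real
    using zero_le_power2[of "1 - 2 * x"] by (simp add: power2_eq_square algebra_simps)
  have s1: "1 - 4 * x * (1 - x) < 1" if "x \<in> {0<..<1}" for x :: real using that by simp
  have \<eta>01: "0 \<le> \<eta> n x" "\<eta> n x \<le> 1" if "x \<in> {0<..<1}" for n x
    using power_le_one[OF s, of x n] s1[OF that] zero_le_power[OF s, of x n]
    by (auto simp: \<eta>_def abs_square_le_1)
  have \<eta>lim: "(\<lambda>n. \<eta> n x) \<longlonglongrightarrow> 1" if "x \<in> {0<..<1}" for x
  proof -
    have "norm (1 - 4 * x * (1 - x)) < 1"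
      unfolding real_norm_def abs_of_nonneg[OF s] by (rule s1[OF that])
    then have "(\<lambda>n. (1 - 4 * x * (1 - x)) ^ n) \<longlonglongrightarrow> 0"
      by (rule LIMSEQ_power_zero)
    then have "(\<lambda>n. \<eta> n x) \<longlonglongrightarrow> (1 - 0)\<^sup>2"
      unfolding \<eta>_def by (intro tendsto_power tendsto_diff tendsto_const)
    then show ?thesis by simp
  qed
  have \<eta>p: "real_polynomial_function (\<eta> n)" for n
    unfolding \<eta>_def
    by (intro real_polynomial_function_power real_polynomial_function_diff real_polynomial_function.intros
         bounded_linear_ident)
  have contq: "continuous_on S (q n)" "continuous_on S (\<eta> n)" for S n
    using q(1) \<eta>p by (auto intro: continuous_on_polymonial_function simp flip: real_polynomial_function_eq)
  have "(\<lambda>n. LINT x|unit_interval. (norm (f x - \<eta> n x *\<^sub>R q n x))\<^sup>2) \<longlonglongrightarrow> (LINT x|unit_interval. 0 :: real)"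
  \<comment> \<open>\<open>K\<close> bounds \<open>f\<close>, and \<open>K + 1\<close> bounds the
    polynomial, which stays within 1 of a function clipped at \<open>K\<close>; the cut-off is at
    most 1.\<close>
  proof (rule integral_dominated_convergence[where w = "\<lambda>_. (2 * K + 1)\<^sup>2"])
    fix n
    show "(\<lambda>x. (norm (f x - \<eta> n x *\<^sub>R q n x))\<^sup>2) \<in> borel_measurable unit_interval"
    proof -
      have "(\<lambda>x. \<eta> n x *\<^sub>R q n x) \<in> borel_measurable unit_interval"
        by (intro continuous_on_measurable_unit_interval continuous_intros contq)
      with f show ?thesis by simp
    qed
    show "AE x in unit_interval. norm ((norm (f x - \<eta> n x *\<^sub>R q n x))\<^sup>2) \<le> (2 * K + 1)\<^sup>2"
    proof (rule AE_I2)
      fix x assume "x \<in> space unit_interval"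
      then have x: "x \<in> {0<..<1}" by simp
      have "norm (q n x) \<le> norm (c n x) + norm (c n x - q n x)"
        using norm_triangle_ineq4[of "c n x" "c n x - q n x"] by simp
      also have "\<dots> \<le> K + 1"
        using cK[of n x] q(2)[of x n] x by (intro add_mono) (auto intro: order_trans[OF less_imp_le])
      finally have "norm (\<eta> n x *\<^sub>R q n x) \<le> 1 * (K + 1)"
        using \<eta>01[OF x, of n] unfolding norm_scaleR by (intro mult_mono) auto
      then have "norm (f x - \<eta> n x *\<^sub>R q n x) \<le> 2 * K + 1"
        using norm_triangle_ineq4[of "f x" "\<eta> n x *\<^sub>R q n x"] K(2)[of x] by simp
      then show "norm ((norm (f x - \<eta> n x *\<^sub>R q n x))\<^sup>2) \<le> (2 * K + 1)\<^sup>2"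
        by (simp add: power_mono)
    qed
  next
    have "AE x in unit_interval. x \<notin> N"
      using N AE_not_in[of N lebesgue] by (auto simp: AE_restrict_space_iff negligible_iff_null_sets)
    then show "AE x in unit_interval. (\<lambda>n. (norm (f x - \<eta> n x *\<^sub>R q n x))\<^sup>2) \<longlonglongrightarrow> 0"
      using AE_space
    proof eventually_elim
      case (elim x)
      then have x: "x \<in> {0<..<1}" by simp
      have "(\<lambda>n. c n x - q n x) \<longlonglongrightarrow> 0"
      proof (rule Lim_null_comparison)
        show "\<forall>\<^sub>F n in sequentially. norm (c n x - q n x) \<le> 1 / real (Suc n)"
          using q(2)[of x] x by (intro always_eventually) (auto intro: less_imp_le)
        show "(\<lambda>n. 1 / real (Suc n)) \<longlonglongrightarrow> 0" using LIMSEQ_inverse_real_of_nat by (simp add: inverse_eq_divide)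
      qed
      then have "(\<lambda>n. c n x - (c n x - q n x)) \<longlonglongrightarrow> f x - 0"
        by (intro tendsto_diff clim[OF elim(1) x])
      then have "(\<lambda>n. (norm (f x - \<eta> n x *\<^sub>R q n x))\<^sup>2) \<longlonglongrightarrow> (norm (f x - 1 *\<^sub>R f x))\<^sup>2"
        by (intro tendsto_intros \<eta>lim[OF x]) simp
      then show ?case by simp
    qed
  qed simp_all
  then have "(\<lambda>n. LINT x|unit_interval. (norm (f x - \<eta> n x *\<^sub>R q n x))\<^sup>2) \<longlonglongrightarrow> 0" by simp
  then have "\<forall>\<^sub>F n in sequentially. (LINT x|unit_interval. (norm (f x - \<eta> n x *\<^sub>R q n x))\<^sup>2) < e"
    by (rule order_tendstoD(2)) (rule e)
  then obtain n where n: "(LINT x|unit_interval. (norm (f x - \<eta> n x *\<^sub>R q n x))\<^sup>2) < e"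
    by (auto simp: eventually_sequentially)
  show ?thesis
  proof (rule that[of "\<eta> n" "q n"])
    show "(\<eta> n has_field_derivative 0) (at 0)" "(\<eta> n has_field_derivative 0) (at 1)"
      unfolding \<eta>_def by (auto intro!: derivative_eq_intros)
    show "\<eta> n 0 = 0" "\<eta> n 1 = 0" by (auto simp: \<eta>_def)
  qed (use \<eta>p q n in auto)
qed

text \<open>\<open>f\<close> is truncated to a bounded function, which is then approximated by a
  polynomial in the domain. Each squared error is below e^2/4, and the factor 2 in |a - b|^2 <=
  2|a|^2 + 2|b|^2 brings the total below e^2.\<close>

lemma densely_defined_matrix_op_D_op: "densely_defined (matrix_op A D_op)"
  unfolding densely_defined_def
proof (intro ballI allI impI)
  fix f :: "real \<Rightarrow> complex^2" and e :: real assume f: "f \<in> L2" and e: "e > 0"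
  note fm = L2_measurable[OF f]
  define tr where "tr n x = (if norm (f x) \<le> real n then f x else 0)" for n :: nat and x
  have trm: "tr n \<in> borel_measurable unit_interval" for n
    unfolding tr_def using fm by measurable
  have "(\<lambda>n. LINT x|unit_interval. (norm (f x - tr n x))\<^sup>2) \<longlonglongrightarrow> (LINT x|unit_interval. 0 :: real)"
  proof (rule integral_dominated_convergence[where w = "\<lambda>x. (norm (f x))\<^sup>2"])
    show "AE x in unit_interval. (\<lambda>n. (norm (f x - tr n x))\<^sup>2) \<longlonglongrightarrow> 0"
    proof (rule AE_I2, rule tendsto_eventually)
      fix x
      obtain m where m: "norm (f x) \<le> real m" using real_arch_simple by blast
      show "\<forall>\<^sub>F n in sequentially. (norm (f x - tr n x))\<^sup>2 = 0"
        unfolding eventually_sequentially tr_def by (rule exI[of _ m]) (use m in auto)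
    qed
  qed (use f fm trm in \<open>auto simp: L2_def tr_def\<close>)
  then have "(\<lambda>n. LINT x|unit_interval. (norm (f x - tr n x))\<^sup>2) \<longlonglongrightarrow> 0" by simp
  then have "\<forall>\<^sub>F n in sequentially. (LINT x|unit_interval. (norm (f x - tr n x))\<^sup>2) < e\<^sup>2 / 4"
    by (rule order_tendstoD(2)) (use e in simp)
  then obtain n where n: "(LINT x|unit_interval. (norm (f x - tr n x))\<^sup>2) < e\<^sup>2 / 4"
    by (auto simp: eventually_sequentially)
  obtain \<eta> q where eq: "real_polynomial_function \<eta>" "polynomial_function q" "\<eta> 0 = 0" "\<eta> 1 = 0"
    "(\<eta> has_field_derivative 0) (at 0)" "(\<eta> has_field_derivative 0) (at 1)"
    "(LINT x|unit_interval. (norm (tr n x - \<eta> x *\<^sub>R q x))\<^sup>2) < e\<^sup>2 / 4"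
  proof (rule L2_approx_polynomial[OF trm[of n], of "real n" "e\<^sup>2 / 4"])
    show "norm (tr n x) \<le> real n" for x by (simp add: tr_def)
  qed (use e in simp_all)
  define u where "u x = \<eta> x *\<^sub>R q x" for x
  have up: "polynomial_function u"
    unfolding u_def using eq(1,2) by (intro polynomial_function_mult) (simp_all add: real_polynomial_function_eq)
  obtain u' where u': "polynomial_function u'" "\<And>x. (u has_vector_derivative u' x) (at x)"
    using has_vector_derivative_polynomial_function[OF up] by blast
  obtain u'' where u'': "polynomial_function u''" "\<And>x. (u' has_vector_derivative u'' x) (at x)"
    using has_vector_derivative_polynomial_function[OF u'(1)] by blast
  obtain q' where q': "\<And>x. (q has_vector_derivative q' x) (at x)"
    using has_vector_derivative_polynomial_function[OF eq(2)] by blast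
  have u'z: "u' z = 0" if "\<eta> z = 0" "(\<eta> has_field_derivative 0) (at z)" for z
  proof -
    have "(u has_vector_derivative (\<eta> z *\<^sub>R q' z + 0 *\<^sub>R q z)) (at z)"
      unfolding u_def by (rule has_vector_derivative_scaleR[OF that(2) q'])
    then show ?thesis using that(1) vector_derivative_unique_at[OF u'(2)] by simp
  qed
  have "(u, \<lambda>x. - (A *v u'' x)) \<in> matrix_op A D_op"
  proof (rule C2_in_matrix_op_D_op[of u u' u''])
    show "continuous_on {0..1} u''" by (rule continuous_on_polymonial_function[OF u''(1)])
    show "mixed_boundary u u'"
      using u'z[of 0] u'z[of 1] eq by (simp add: mixed_boundary_def u_def)
  qed (use u' u'' in \<open>auto intro: has_vector_derivative_at_within\<close>)
  then have uD: "u \<in> Domain (matrix_op A D_op)" by blast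
  have uL: "u \<in> L2" by (intro L2_continuous continuous_on_polymonial_function up)
  have trL: "tr n \<in> L2" by (rule L2_boundedI[OF trm, of _ "real n"]) (auto simp: tr_def)
  have i: "integrable unit_interval (\<lambda>x. (norm (f x - tr n x))\<^sup>2)" "integrable unit_interval (\<lambda>x. (norm (tr n x - u x))\<^sup>2)"
      "integrable unit_interval (\<lambda>x. (norm (f x - u x))\<^sup>2)"
    using L2_diff[OF f trL] L2_diff[OF trL uL] L2_diff[OF f uL] by (simp_all add: L2_def)
  have "(LINT x|unit_interval. (norm (f x - u x))\<^sup>2) \<le>
     (LINT x|unit_interval. 2 * (norm (f x - tr n x))\<^sup>2 + 2 * (norm (tr n x - u x))\<^sup>2)"
  proof (rule integral_mono)
    fix x
    show "(norm (f x - u x))\<^sup>2 \<le> 2 * (norm (f x - tr n x))\<^sup>2 + 2 * (norm (tr n x - u x))\<^sup>2"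
      using norm_diff_square_le[of "f x - tr n x" "u x - tr n x"] by (simp add: norm_minus_commute)
  qed (use i in auto)
  also have "\<dots> = 2 * (LINT x|unit_interval. (norm (f x - tr n x))\<^sup>2) + 2 * (LINT x|unit_interval. (norm (tr n x - u x))\<^sup>2)"
    using i by simp
  also have "\<dots> < e\<^sup>2" using n eq(7) by (simp add: u_def)
  finally have "L2_norm (\<lambda>x. f x - u x) < sqrt (e\<^sup>2)"
    unfolding L2_norm_def by (rule real_sqrt_less_mono)
  then show "\<exists>u\<in>Domain (matrix_op A D_op). L2_norm (\<lambda>x. f x - u x) < e"
    using uD e by auto
qed

section \<open>Self-adjointness\<close>

lemma cinner_self_adjoint:
  fixes A :: "complex^2^2"
  assumes "real_matrix A" "diagonal_matrix A"
  shows "cinner (A *v x) y = cinner x (A *v y)"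
  using assms
  by (simp add: cinner_def matrix_vector_mult_def sum_2 real_matrix_def diagonal_matrix_def Reals_cnj_iff)

text \<open>Green's formula is applied to the form \<open>cinner (A *v x) y\<close>. That
  \<open>A\<close> is diagonal removes the boundary terms; together with its entries being real, it
  lets \<open>A\<close> move to the other argument afterwards.\<close>

lemma matrix_op_D_op_symmetric:
  assumes A: "real_matrix A" "diagonal_matrix A"
    and f: "(f, k) \<in> matrix_op A D_op" and g: "(g, l) \<in> matrix_op A D_op"
  shows "L2_inner k g = L2_inner f l"
proof -
  obtain F p h where fL: "f \<in> L2" "k \<in> L2" and F: "h \<in> L2" "second_order_primitive F p h" "mixed_boundary F p"
    "AE x in unit_interval. f x = F x" "AE x in unit_interval. k x = - (A *v h x)"
    using f unfolding matrix_op_D_op_iff by blast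
  obtain G q j where gL: "g \<in> L2" "l \<in> L2" and G: "j \<in> L2" "second_order_primitive G q j" "mixed_boundary G q"
    "AE x in unit_interval. g x = G x" "AE x in unit_interval. l x = - (A *v j x)"
    using g unfolding matrix_op_D_op_iff by blast
  have FL: "F \<in> L2" and GL: "G \<in> L2"
    using second_order_primitive_continuous(1) F(2) G(2) by (auto intro: L2_continuous)
  note m = L2_measurable L2_uminus L2_matrix
  have bil: "bounded_bilinear (\<lambda>x. cinner (A *v x) :: complex^2 \<Rightarrow> complex)"
    by (rule bounded_bilinear.comp1[OF bounded_bilinear_cinner bounded_linear_matrix_vector_mult])
  have "L2_inner k g = (LINT x|unit_interval. cinner (- (A *v h x)) (G x))"
    unfolding L2_inner_cinner
    by (rule integral_cong_AE) (use F G in \<open>auto intro!: cinner_measurable m fL gL FL GL\<close>)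
  also have "\<dots> = - integral {0..1} (\<lambda>x. cinner (A *v h x) (G x))"
    using cinner_integrable[OF L2_matrix[OF F(1), of A] GL]
    by (simp add: cinner.minus_left integral_unit_interval integrable_unit_interval_iff)
  also have "integral {0..1} (\<lambda>x. cinner (A *v h x) (G x)) = integral {0..1} (\<lambda>x. cinner (A *v F x) (j x))"
  proof -
    \<comment> \<open>A diagonal \<open>A\<close> pairs equal components only. In component 1 the
      factors \<open>G z\<close> and \<open>F z\<close> vanish, in component 2 the factors
      \<open>p z\<close> and \<open>q z\<close>.\<close>
    have "cinner (A *v p z) (G z) = 0" "cinner (A *v F z) (q z) = 0" if "z = 0 \<or> z = 1" for z
      using that F(3) G(3) A(2)
      by (auto simp: cinner_def matrix_vector_mult_def sum_2 diagonal_matrix_def mixed_boundary_def)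
    then show ?thesis
      using Green_second_order_primitive[OF bil F(2) G(2)] by simp
  qed
  also have "\<dots> = integral {0..1} (\<lambda>x. cinner (F x) (A *v j x))"
    by (simp add: cinner_self_adjoint[OF A])
  also have "- \<dots> = (LINT x|unit_interval. cinner (F x) (- (A *v j x)))"
    using cinner_integrable[OF FL L2_matrix[OF G(1), of A]]
    by (simp add: cinner.minus_right integral_unit_interval integrable_unit_interval_iff)
  also have "\<dots> = L2_inner f l"
    unfolding L2_inner_cinner
    by (rule integral_cong_AE) (use F G in \<open>auto intro!: cinner_measurable m fL gL FL GL\<close>)
  finally show ?thesis .
qed

section \<open>Solving the boundary value problem and bounding the adjoint\<close>

lemma integral_has_vector_derivative_Icc:
  fixes f :: "real \<Rightarrow> 'a::banach"
  assumes "continuous_on {a..b} f" "x \<in> {a..b}"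
  shows "((\<lambda>x. c + integral {a..x} f) has_vector_derivative f x) (at x within {a..b})"
  using integral_has_vector_derivative[OF assms]
  by (auto intro!: derivative_eq_intros)

text \<open>With zero slope at 0, the second component has slope at 1 equal to the integral of
  \<open>w $ 2\<close>, hence the mean condition. Its additive constant remains free and is used to
  prescribe the mean \<open>c\<close>. In component 1 the initial slope is free and is chosen to hit
  0 at 1.\<close>

lemma mixed_boundary_problem_solvable:
  fixes w :: "real \<Rightarrow> complex^2"
  assumes w: "w absolutely_integrable_on {0..1}" and mean: "integral {0..1} w $ 2 = 0"
  obtains F p where "second_order_primitive F p w" "mixed_boundary F p" "integral {0..1} F $ 2 = c"
proof -
  define W where "W x = integral {0..x} w" for x
  define V where "V x = integral {0..x} W" for x
  \<comment> \<open>The solution is \<open>F x = F0 + x *\<^sub>R p0 + V x\<close>. The first entry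
    of \<open>p0\<close> makes \<open>F 1 $ 1\<close> vanish. As the second entry of
    \<open>p0\<close> is 0, the second mean of \<open>F\<close> is that of \<open>V\<close> plus
    \<open>F0 $ 2\<close>, which fixes \<open>F0 $ 2\<close>.\<close>
  define p0 :: "complex^2" where "p0 = (\<chi> i. if i = 1 then - (V 1 $ 1) else 0)"
  define F0 :: "complex^2" where "F0 = (\<chi> i. if i = 1 then 0 else c - integral {0..1} V $ 2)"
  define p where "p x = p0 + W x" for x
  define F where "F x = F0 + integral {0..x} p" for x
  have wi: "w integrable_on {0..1}" using w by (simp add: absolutely_integrable_on_def)
  have cW: "continuous_on {0..1} W" unfolding W_def by (rule indefinite_integral_continuous_1[OF wi])
  have cV: "continuous_on {0..1} V"
    unfolding V_def by (rule indefinite_integral_continuous_1[OF integrable_continuous_real[OF cW]])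
  have cp: "continuous_on {0..1} p" unfolding p_def by (intro continuous_intros cW)
  have Feq: "F x = F0 + (x *\<^sub>R p0 + V x)" if "x \<in> {0..1}" for x
  proof -
    have "W integrable_on {0..x}"
      using that by (intro integrable_continuous_real continuous_on_subset[OF cW]) auto
    then have "integral {0..x} p = integral {0..x} (\<lambda>_. p0) + V x"
      unfolding p_def V_def by (intro Henstock_Kurzweil_Integration.integral_add integrable_const_ivl)
    then show ?thesis using that by (simp add: F_def)
  qed
  have s: "second_order_primitive F p w"
    unfolding second_order_primitive_def
  proof (intro conjI ballI w)
    fix x :: real assume x: "x \<in> {0..1}"
    show "(F has_vector_derivative p x) (at x within {0..1})"
      unfolding F_def by (rule integral_has_vector_derivative_Icc[OF cp x])
    have "w integrable_on {0..x}" using x by (intro integrable_on_subinterval[OF wi]) auto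
    then show "(w has_integral (p x - p 0)) {0..x}" by (simp add: p_def W_def integrable_integral)
  qed
  have "V 0 = 0" "W 0 = 0" by (simp_all add: V_def W_def)
  then have "mixed_boundary F p"
    using mean by (simp add: mixed_boundary_def Feq p_def F0_def p0_def W_def[of 1])
  moreover have "integral {0..1} F $ 2 = c"
  proof -
    have "integral {0..1} F = integral {0..1} (\<lambda>x. F0 + (x *\<^sub>R p0 + V x))"
      by (rule Henstock_Kurzweil_Integration.integral_cong) (rule Feq)
    also have "\<dots> = F0 + integral {0..1} (\<lambda>x. x *\<^sub>R p0 + V x)"
      by (subst Henstock_Kurzweil_Integration.integral_add)
        (auto intro!: integrable_continuous_real continuous_intros cV)
    also have "integral {0..1} (\<lambda>x. x *\<^sub>R p0 + V x) = integral {0..1} (\<lambda>x. x *\<^sub>R p0) + integral {0..1} V"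
      by (subst Henstock_Kurzweil_Integration.integral_add)
        (auto intro!: integrable_continuous_real continuous_intros cV)
    also have "integral {0..1} (\<lambda>x::real. x *\<^sub>R p0) = (1 / 2) *\<^sub>R p0"
    proof -
      have "((\<lambda>x::real. x) has_integral 1 / 2) {0..1}" using ident_has_integral[of 0 1] by simp
      from has_integral_scaleR_left[OF this, of p0] show ?thesis by (rule integral_unique)
    qed
    finally show ?thesis by (simp add: F0_def p0_def)
  qed
  ultimately show ?thesis using that s by blast
qed

text \<open>Needed so that applying the inverse of \<open>A\<close> preserves a vanishing mean in
  the second component.\<close>

lemma diagonal_matrix_right_inverse:
  fixes A B :: "complex^2^2"
  assumes A: "diagonal_matrix A" and AB: "A ** B = mat 1"
  shows "diagonal_matrix B"
proof -
  have e: "A $ i $ i * B $ i $ j = (if i = j then 1 else 0)" for i j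
  proof -
    have "(A ** B) $ i $ j = A $ i $ i * B $ i $ j"
      using A exhaust_2[of i] by (auto simp: matrix_matrix_mult_def sum_2 diagonal_matrix_def)
    then show ?thesis by (simp add: AB mat_def)
  qed
  then have "A $ i $ i \<noteq> 0" for i by (metis mult_zero_left zero_neq_one)
  then show ?thesis using e unfolding diagonal_matrix_def by (metis mult_eq_0_iff)
qed

text \<open>The solution \<open>U\<close> of AD U = v is determined only up to multiples of e_2.
  Matching the second mean of \<open>u\<close> selects the one for which the difference
  \<open>d = u - U\<close> lies in the range of AD; then \<open>d\<close> is orthogonal to
  \<open>u\<close> and to \<open>U\<close> by the same amount.\<close>

lemma adjoint_matrix_op_D_op_subset:
  assumes inv: "invertible A" and A: "real_matrix A" "diagonal_matrix A"
  shows "adjoint_op (matrix_op A D_op) \<subseteq> matrix_op A D_op"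
proof (rule subrelI)
  fix u v assume "(u, v) \<in> adjoint_op (matrix_op A D_op)"
  then have u: "u \<in> L2" and v: "v \<in> L2"
    and adj: "\<And>f g. (f, g) \<in> matrix_op A D_op \<Longrightarrow> L2_inner g u = L2_inner f v"
    unfolding adjoint_op_def by auto
  obtain B where AB: "A ** B = mat 1" using inv unfolding invertible_def by blast
  have B: "diagonal_matrix B" by (rule diagonal_matrix_right_inverse[OF A(2) AB])
  have ABx: "A *v (B *v x) = x" for x by (simp add: matrix_vector_mul_assoc AB)
  have mean_B: "integral {0..1} (\<lambda>x. B *v f x) $ 2 = 0"
    if "f \<in> L2" "integral {0..1} f $ 2 = 0" for f
  proof -
    have "integral {0..1} (\<lambda>x. B *v f x) = B *v integral {0..1} f"
      using integral_linear[OF _ bounded_linear_matrix_vector_mult, of f "{0..1}" B] L2_integrable[OF that(1)]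
      by (simp add: o_def absolutely_integrable_on_def)
    then show ?thesis using that(2) B by (simp add: matrix_vector_mult_def sum_2 diagonal_matrix_def)
  qed
  have hk: "f integrable_on {0..1}" if "f \<in> L2" for f
    using L2_integrable[OF that] by (simp add: absolutely_integrable_on_def)
  have mean_v: "integral {0..1} v $ 2 = 0"
  proof -
    have "(\<lambda>_. axis 2 1, \<lambda>x. - (A *v 0)) \<in> matrix_op A D_op"
      by (rule C2_in_matrix_op_D_op[where p = "\<lambda>_. 0"]) (auto simp: mixed_boundary_def axis_def)
    from adj[OF this] have "0 = (LINT x|unit_interval. cinner (axis 2 1) (v x))"
      by (simp add: L2_inner_cinner cinner.zero_left)
    also have "\<dots> = cinner (axis 2 1) (LINT x|unit_interval. v x)"
      by (rule integral_bounded_linear[OF cinner.bounded_linear_right])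
         (simp add: integrable_unit_interval_iff L2_integrable v)
    also have "\<dots> = cnj (integral {0..1} v $ 2)"
      by (simp add: integral_unit_interval L2_integrable v cinner_def sum_2 axis_def)
    finally show ?thesis by simp
  qed
  \<comment> \<open>The required second derivative: AD U = -A U'' equals \<open>v\<close> when U'' =
    -B v.\<close>
  define w where "w x = - (B *v v x)" for x
  have w: "w \<in> L2" unfolding w_def by (intro L2_uminus L2_matrix v)
  have "integral {0..1} w $ 2 = 0" unfolding w_def using mean_B[OF v mean_v] by simp
  then obtain U p where U: "second_order_primitive U p w" "mixed_boundary U p" "integral {0..1} U $ 2 = integral {0..1} u $ 2"
    using mixed_boundary_problem_solvable[OF L2_integrable[OF w]] by metis
  have UL: "U \<in> L2" by (rule L2_continuous[OF second_order_primitive_continuous(1)[OF U(1)]])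
  have UT: "(U, v) \<in> matrix_op A D_op"
    by (rule matrix_op_D_opI[OF UL v w U(1,2)]) (auto simp: w_def ABx)
  define d where "d x = u x - U x" for x
  have d: "d \<in> L2" unfolding d_def by (rule L2_diff[OF u UL])
  have "integral {0..1} d $ 2 = 0"
    unfolding d_def using U(3) by (simp add: Henstock_Kurzweil_Integration.integral_diff[OF hk[OF u] hk[OF UL]])
  \<comment> \<open>Here F'' = B d, so AD F = -d; this places \<open>d\<close> in the range of
    AD.\<close>
  from mean_B[OF d this] obtain F q where F: "second_order_primitive F q (\<lambda>x. B *v d x)" "mixed_boundary F q"
    using mixed_boundary_problem_solvable[OF L2_integrable[OF L2_matrix[OF d]]] by metis
  have FT: "(F, \<lambda>x. - d x) \<in> matrix_op A D_op"
    by (rule matrix_op_D_opI[OF L2_continuous[OF second_order_primitive_continuous(1)[OF F(1)]]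
          L2_uminus[OF d] L2_matrix[OF d] F]) (auto simp: ABx)
  \<comment> \<open>Both sides equal \<open>L2_inner F v\<close>: the left by the adjoint relation
    for \<open>(u, v)\<close>, the right by symmetry, since \<open>(U, v)\<close> is in the graph.
    Subtracting gives <d, d> = 0.\<close>
  have "L2_inner (\<lambda>x. - d x) u = L2_inner (\<lambda>x. - d x) U"
    using adj[OF FT] matrix_op_D_op_symmetric[OF A FT UT] by simp
  then have "(LINT x|unit_interval. cinner (- d x) (u x)) - (LINT x|unit_interval. cinner (- d x) (U x)) = 0"
    by (simp add: L2_inner_cinner)
  then have "(LINT x|unit_interval. cinner (- d x) (u x) - cinner (- d x) (U x)) = 0"
    using cinner_integrable[OF L2_uminus[OF d] u] cinner_integrable[OF L2_uminus[OF d] UL] by simp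
  also have "(\<lambda>x. cinner (- d x) (u x) - cinner (- d x) (U x)) = (\<lambda>x. - of_real ((norm (d x))\<^sup>2))"
    unfolding cinner.diff_right[symmetric] unfolding d_def[symmetric] cinner.minus_left cinner_self ..
  finally have "(LINT x|unit_interval. (norm (d x))\<^sup>2) = 0"
    by (simp flip: of_real_power)
  then have "AE x in unit_interval. (norm (d x))\<^sup>2 = 0"
    using d by (subst (asm) integral_nonneg_eq_0_iff_AE) (auto simp: L2_def)
  then have "AE x in unit_interval. u x = U x" by (simp add: d_def)
  then show "(u, v) \<in> matrix_op A D_op"
    by (rule matrix_op_D_opI[OF u v w U(1,2)]) (auto simp: w_def ABx)
qed

section \<open>Necessity: symmetry forces a real diagonal matrix\<close>

text \<open>On \<phi> e_i and \<psi> e_j the two sides of the symmetry relation factor into a matrix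
  entry times a scalar integral: -A_ji times the integral of \<phi>'' \<psi>, and -cnj(A_ij) times
  the integral of \<phi> \<psi>''. Keeping the values \<open>a\<close> and \<open>b\<close> separate
  lets boundary terms show up as \<open>a \<noteq> b\<close>.\<close>

lemma matrix_op_D_op_test_functions:
  fixes A :: "complex^2^2" and \<phi> \<psi> :: "real \<Rightarrow> real"
  assumes sym: "matrix_op A D_op \<subseteq> adjoint_op (matrix_op A D_op)"
    and d\<phi>: "\<And>x. (\<phi> has_field_derivative \<phi>' x) (at x)" "\<And>x. (\<phi>' has_field_derivative \<phi>'' x) (at x)"
    and d\<psi>: "\<And>x. (\<psi> has_field_derivative \<psi>' x) (at x)" "\<And>x. (\<psi>' has_field_derivative \<psi>'' x) (at x)"
    and c: "continuous_on {0..1} \<phi>''" "continuous_on {0..1} \<psi>''"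
    and bc: "mixed_boundary (\<lambda>x. \<phi> x *\<^sub>R axis i 1) (\<lambda>x. \<phi>' x *\<^sub>R axis i 1)"
      "mixed_boundary (\<lambda>x. \<psi> x *\<^sub>R axis j 1) (\<lambda>x. \<psi>' x *\<^sub>R axis j 1)"
    and I: "((\<lambda>x. \<phi>'' x * \<psi> x) has_integral a) {0..1}" "((\<lambda>x. \<phi> x * \<psi>'' x) has_integral b) {0..1}"
  shows "a *\<^sub>R A $ j $ i = b *\<^sub>R cnj (A $ i $ j)"
proof -
  have dv: "((\<lambda>x. g x *\<^sub>R axis l 1 :: complex^2) has_vector_derivative g' x *\<^sub>R axis l 1) (at x within {0..1})"
    if "(g has_field_derivative g' x) (at x)" for g g' :: "real \<Rightarrow> real" and l x
    using has_vector_derivative_scaleR[OF has_field_derivative_at_within[OF that], of "\<lambda>_. axis l 1" 0 "{0..1}"] by simp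
  have c0: "continuous_on S \<phi>" "continuous_on S \<psi>" for S
    using d\<phi>(1) d\<psi>(1) by (meson DERIV_isCont continuous_at_imp_continuous_on)+
  have T: "(\<lambda>x. \<phi> x *\<^sub>R axis i 1, \<lambda>x. - (A *v (\<phi>'' x *\<^sub>R axis i 1))) \<in> matrix_op A D_op"
    by (rule C2_in_matrix_op_D_op[OF _ _ _ bc(1)]) (intro dv d\<phi> continuous_intros c)+
  have "(\<lambda>x. \<psi> x *\<^sub>R axis j 1, \<lambda>x. - (A *v (\<psi>'' x *\<^sub>R axis j 1))) \<in> matrix_op A D_op"
    by (rule C2_in_matrix_op_D_op[OF _ _ _ bc(2)]) (intro dv d\<psi> continuous_intros c)+
  then have "(\<lambda>x. \<psi> x *\<^sub>R axis j 1, \<lambda>x. - (A *v (\<psi>'' x *\<^sub>R axis j 1))) \<in> adjoint_op (matrix_op A D_op)"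
    using sym by blast
  with T have eq: "L2_inner (\<lambda>x. - (A *v (\<phi>'' x *\<^sub>R axis i 1))) (\<lambda>x. \<psi> x *\<^sub>R axis j 1) =
      L2_inner (\<lambda>x. \<phi> x *\<^sub>R axis i 1) (\<lambda>x. - (A *v (\<psi>'' x *\<^sub>R axis j 1)))"
    unfolding adjoint_op_def by blast
  have sc: "A *v (r *\<^sub>R x) = r *\<^sub>R (A *v x)" for r x
    using bounded_linear_matrix_vector_mult[of A] by (rule linear_scale[OF bounded_linear.linear])
  have ent: "cinner (A *v axis i 1) (axis j 1) = A $ j $ i" "cinner (axis i 1) (A *v axis j 1) = cnj (A $ i $ j)"
    using exhaust_2[of i] exhaust_2[of j] by (auto simp: cinner_def matrix_vector_mult_def axis_def sum_2)
  have L: "(LINT x|unit_interval. - ((g x * k x) *\<^sub>R z)) = - (y *\<^sub>R z)"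
    if "continuous_on {0..1} g" "continuous_on {0..1} k" "((\<lambda>x. g x * k x) has_integral y) {0..1}"
    for g k :: "real \<Rightarrow> real" and y and z :: complex
  proof -
    have "(\<lambda>x. - ((g x * k x) *\<^sub>R z)) absolutely_integrable_on {0..1}"
      using that by (intro absolutely_integrable_continuous_real continuous_intros)
    from integral_unit_interval[OF this] show ?thesis
      unfolding integral_unique[OF has_integral_neg[OF has_integral_scaleR_left[OF that(3), of z]]] .
  qed
  have "- (a *\<^sub>R A $ j $ i) = L2_inner (\<lambda>x. - (A *v (\<phi>'' x *\<^sub>R axis i 1))) (\<lambda>x. \<psi> x *\<^sub>R axis j 1)"
    using L[OF c(1) c0(2) I(1), of "A $ j $ i"]
    by (simp add: L2_inner_cinner sc cinner.minus_left cinner.scaleR_left cinner.scaleR_right ent mult.commute)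
  also note eq
  also have "L2_inner (\<lambda>x. \<phi> x *\<^sub>R axis i 1) (\<lambda>x. - (A *v (\<psi>'' x *\<^sub>R axis j 1))) = - (b *\<^sub>R cnj (A $ i $ j))"
    using L[OF c0(1) c(2) I(2), of "cnj (A $ i $ j)"]
    by (simp add: L2_inner_cinner sc cinner.minus_right cinner.scaleR_left cinner.scaleR_right ent mult.commute)
  finally show ?thesis by simp
qed

text \<open>Double zeros make x^2(1-x)^2 admissible in either component, with no boundary terms and
  a = b nonzero, so \<open>A\<close> is Hermitian. For \<phi> = x(1-x) in component 1 and \<psi> = 1
  in component 2 the boundary term of \<phi>' \<psi> survives: b = 0 but a = -2, which forces A_21 =
  0. Hermitian symmetry then gives A_12 = 0 and real diagonal entries.\<close>

lemma symmetric_matrix_op_D_op_imp: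
  fixes A :: "complex^2^2"
  assumes sym: "matrix_op A D_op \<subseteq> adjoint_op (matrix_op A D_op)"
  shows "real_matrix A \<and> diagonal_matrix A"
proof -
  have herm: "A $ j $ i = cnj (A $ i $ j)" for i j
  proof -
    define \<phi> \<phi>' \<phi>'' :: "real \<Rightarrow> real" where
      "\<phi> = (\<lambda>x. x\<^sup>2 - 2 * x ^ 3 + x ^ 4)" and "\<phi>' = (\<lambda>x. 2 * x - 6 * x\<^sup>2 + 4 * x ^ 3)" and
      "\<phi>'' = (\<lambda>x. 2 - 12 * x + 12 * x\<^sup>2)"
    have 1: "(\<phi> has_field_derivative \<phi>' x) (at x)" "(\<phi>' has_field_derivative \<phi>'' x) (at x)" for x
      by (auto simp: \<phi>_def \<phi>'_def \<phi>''_def power2_eq_square intro!: derivative_eq_intros)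
    have 2: "mixed_boundary (\<lambda>x. \<phi> x *\<^sub>R axis l 1) (\<lambda>x. \<phi>' x *\<^sub>R axis l 1)" for l
      by (simp add: mixed_boundary_def \<phi>_def \<phi>'_def)
    \<comment> \<open>The antiderivative of \<phi>'' \<phi> = 2x^2 - 16x^3 + 38x^4 - 36x^5 + 12x^6.
      Its increment -2/105 is minus the integral of the square of \<phi>', hence nonzero, and can be
      cancelled.\<close>
    define P :: "real \<Rightarrow> real" where
      "P = (\<lambda>x. 2 / 3 * x ^ 3 - 4 * x ^ 4 + 38 / 5 * x ^ 5 - 6 * x ^ 6 + 12 / 7 * x ^ 7)"
    have "((\<lambda>x. \<phi>'' x * \<phi> x) has_integral P 1 - P 0) {0..1}"
    proof (rule fundamental_theorem_of_calculus)
      fix x :: real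
      have "(P has_field_derivative \<phi>'' x * \<phi> x) (at x)"
        unfolding P_def
        by (rule derivative_eq_intros refl)+ (simp add: \<phi>_def \<phi>''_def algebra_simps eval_nat_numeral)
      then show "(P has_vector_derivative \<phi>'' x * \<phi> x) (at x within {0..1})"
        by (simp add: has_field_derivative_at_within flip: has_real_derivative_iff_has_vector_derivative)
    qed simp
    then have 3: "((\<lambda>x. \<phi>'' x * \<phi> x) has_integral - (2 / 105)) {0..1}" by (simp add: P_def)
    then have 4: "((\<lambda>x. \<phi> x * \<phi>'' x) has_integral - (2 / 105)) {0..1}" by (simp add: mult.commute)
    have "continuous_on {0..1} \<phi>''" unfolding \<phi>''_def by (intro continuous_intros)
    from matrix_op_D_op_test_functions[OF sym 1 1 this this 2 2 3 4, of j i] show ?thesis by simp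
  qed
  have "A $ 2 $ 1 = 0"
  proof -
    define \<phi> :: "real \<Rightarrow> real" where "\<phi> = (\<lambda>x. x - x\<^sup>2)"
    have "(-2) *\<^sub>R A $ 2 $ 1 = 0 *\<^sub>R cnj (A $ 1 $ 2)"
    proof (rule matrix_op_D_op_test_functions[OF sym, where \<phi> = \<phi> and \<phi>' = "\<lambda>x. 1 - 2 * x" and \<phi>'' = "\<lambda>_. - 2"
          and \<psi> = "\<lambda>_. 1" and \<psi>' = "\<lambda>_. 0" and \<psi>'' = "\<lambda>_. 0"])
      show "mixed_boundary (\<lambda>x. \<phi> x *\<^sub>R axis 1 1) (\<lambda>x. (1 - 2 * x) *\<^sub>R axis 1 1)"
        "mixed_boundary (\<lambda>x. 1 *\<^sub>R axis 2 1) (\<lambda>x. 0 *\<^sub>R axis 2 1)"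
        by (simp_all add: mixed_boundary_def \<phi>_def axis_def)
      show "((\<lambda>x::real. - 2 * 1 :: real) has_integral - 2) {0..1}"
        using has_integral_const_real[of "-2 :: real" 0 1] by simp
    qed (auto simp: \<phi>_def intro!: derivative_eq_intros)
    then show ?thesis by simp
  qed
  moreover have "A $ 1 $ 2 = 0" using herm[of 1 2] calculation by simp
  moreover have "A $ i $ i \<in> \<real>" for i using herm[of i i] by (simp add: Reals_cnj_iff)
  ultimately show ?thesis
    by (simp add: real_matrix_def diagonal_matrix_def forall_2)
qed

theorem corollary3:
  fixes A :: "complex^2^2"
  assumes "invertible A"
  shows "self_adjoint (matrix_op A D_op) \<longleftrightarrow> real_matrix A \<and> diagonal_matrix A"
proof
  assume "self_adjoint (matrix_op A D_op)"
  then show "real_matrix A \<and> diagonal_matrix A"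
    by (intro symmetric_matrix_op_D_op_imp) (simp add: self_adjoint_def)
next
  assume A: "real_matrix A \<and> diagonal_matrix A"
  have "matrix_op A D_op \<subseteq> adjoint_op (matrix_op A D_op)"
  proof (rule subrelI)
    fix u v assume uv: "(u, v) \<in> matrix_op A D_op"
    then have "u \<in> L2" "v \<in> L2" by (auto simp: matrix_op_D_op_iff)
    then show "(u, v) \<in> adjoint_op (matrix_op A D_op)"
      using matrix_op_D_op_symmetric[OF _ _ _ uv] A unfolding adjoint_op_def by auto
  qed
  with adjoint_matrix_op_D_op_subset[OF assms] A
  show "self_adjoint (matrix_op A D_op)"
    by (auto simp: self_adjoint_def densely_defined_matrix_op_D_op)
qed

end
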